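(* Let $f(z)=\sum_{k\ge 0}a_kz^k\in\mathbb{Z}[[z]]$ be a generalized Liouville series of bounded type, and let $m\ge2$ be an integer. Then there exists a positive number $C$, depending only on $f$ and $m$, such that for every $X\ge2$ there exist at least $2^mX^{m-1}-CX^{m-3/2}\log X$ algebraic numbers $\alpha$ of degree $m$ with $|\alpha|<1$ and $|M_\alpha|\le X$, such that $f(\alpha)$ is a $U_m$-number, that is, $f(\alpha)\in U_m$.
   Context: Throughout, power series $f(z)=\sum_{k\ge0}a_kz^k$ have integer coefficients, positive radius of convergence $R_f$, and infinitely many non-zero coefficients. Such an $f$ is called a generalized Liouville series if there exist integer sequences $(s_n)_{n\ge1}$, $(t_n)_{n\ge0}$ such that: $0\le t_0\le s_1<t_1\le s_2<t_2\le s_3<\cdots$ (that is, $t_{n-1}\le s_n<t_n$ for all $n\ge1$); $a_k=0$ for $k<t_0$ and for $s_n<k<t_n$ ($n=1,2,\ldots$); $t_n/s_n\to\infty$ as $n\to\infty$; and the quotients $s_{n+1}/t_n$ ($n\ge1$) are bounded. The series $f$ is of bounded type if there exists $A>0$ such that $|a_k|\le A$ for all $k$; in this case $R_f=1$. Algebraic numbers are complex algebraic numbers, and the degree is the degree over $\mathbb{Q}$. For a complex algebraic number $\beta$, its minimal polynomial $M_\beta(T)\in\mathbb{Z}[T]$ is the polynomial, irreducible in the ring $\mathbb{Z}[T]$, vanishing at $\beta$ (unique up to sign); $|M_\beta|$ denotes the maximum of the absolute values of its coefficients. For a positive integer $m$, $U_m$ is the set of complex transcendental numbers $\gamma$ such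 that $m$ is the smallest positive integer with the property: for every $w>0$ there exist infinitely many complex algebraic numbers $\beta$ of degree $m$ satisfying $|\gamma-\beta|<|M_\beta|^{-w}$. *)

theory Defs
  imports "HOL-Analysis.Analysis" "HOL-Computational_Algebra.Computational_Algebra"
begin

definition complex_fps :: "int fps \<Rightarrow> complex fps" where
  "complex_fps f = Abs_fps (\<lambda>k. of_int (fps_nth f k))"

text \<open>
  Since \<open>0 \<le> t 0 \<le> s 1 < t 1 \<le> s 2 < \<dots>\<close>, both sequences are taken in the natural numbers.
  The value \<open>s 0\<close> is never used. The value \<open>s 1 = 0\<close> is possible, but then it affects only the
  first quotient \<open>t n / s n\<close>, which is irrelevant for the limit.
\<close>

definition generalized_liouville_series :: "int fps \<Rightarrow> bool" where
  "generalized_liouville_series f \<longleftrightarrow>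
     fps_conv_radius (complex_fps f) > 0 \<and>
     infinite {k. fps_nth f k \<noteq> 0} \<and>
     (\<exists>s t :: nat \<Rightarrow> nat.
        (\<forall>n\<ge>1. t (n - 1) \<le> s n \<and> s n < t n) \<and>
        (\<forall>k < t 0. fps_nth f k = 0) \<and>
        (\<forall>n\<ge>1. \<forall>k. s n < k \<and> k < t n \<longrightarrow> fps_nth f k = 0) \<and>
        filterlim (\<lambda>n. real (t n) / real (s n)) at_top sequentially \<and>
        (\<exists>B. \<forall>n\<ge>1. real (s (n + 1)) / real (t n) \<le> B))"

definition bounded_type :: "int fps \<Rightarrow> bool" where
  "bounded_type f \<longleftrightarrow> (\<exists>A>0. \<forall>k. real_of_int \<bar>fps_nth f k\<bar> \<le> A)"

text \<open>Degree over the rationals, meaningful for algebraic \<open>\<beta>\<close> only.\<close>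

definition algebraic_degree :: "complex \<Rightarrow> nat" where
  "algebraic_degree \<beta> =
     (LEAST n. \<exists>p :: rat poly. p \<noteq> 0 \<and> degree p = n \<and> poly (map_poly of_rat p) \<beta> = 0)"

text \<open>
  The minimal polynomial is irreducible in the ring of integer polynomials, hence primitive. It is
  determined only up to sign; nothing below depends on the sign chosen.
\<close>

definition int_min_poly :: "complex \<Rightarrow> int poly" where
  "int_min_poly \<beta> = (SOME P. irreducible P \<and> poly (map_poly of_int P) \<beta> = 0)"

definition max_abs_coeff :: "int poly \<Rightarrow> int" where
  "max_abs_coeff P = Max (range (\<lambda>i. \<bar>coeff P i\<bar>))"

definition well_approximable :: "nat \<Rightarrow> complex \<Rightarrow> bool" where
  "well_approximable m \<gamma> \<longleftrightarrow>
     (\<forall>w::real. w > 0 \<longrightarrow>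
        infinite {\<beta>. algebraic \<beta> \<and> algebraic_degree \<beta> = m \<and>
          cmod (\<gamma> - \<beta>) < real_of_int (max_abs_coeff (int_min_poly \<beta>)) powr (- w)})"

definition U_numbers :: "nat \<Rightarrow> complex set" where
  "U_numbers m = {\<gamma>. \<not> algebraic \<gamma> \<and> m > 0 \<and> well_approximable m \<gamma> \<and>
     (\<forall>k. 0 < k \<and> k < m \<longrightarrow> \<not> well_approximable k \<gamma>)}"

end

theory Submission
  imports Defs "Berlekamp_Zassenhaus.Factor_Bound" "Jordan_Normal_Form.Char_Poly"
begin

text \<open>
  The numbers \<open>\<alpha>\<close> are algebraic units. The monic integer polynomials of degree \<open>m\<close> with constant
  coefficient \<open>1\<close> or \<open>-1\<close> and coefficients of absolute value at most \<open>X\<close> number about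
  \<open>2 (2 X)^(m - 1) = 2^m X^(m - 1)\<close>, the main term. Two kinds of them are discarded. Reducible ones
  factor into two polynomials with leading and constant coefficient \<open>1\<close> or \<open>-1\<close>, whose other
  coefficients are \<open>O(X)\<close> by the bound of Mignotte; hence there are only \<open>O(X^(m - 2))\<close> of them
  (\<open>card_reducible\<close>). Those whose coefficient of degree \<open>m - 1\<close> is \<open>O(sqrt X)\<close> number
  \<open>O(X^(m - 3/2))\<close> (\<open>card_small_trace\<close>). In a remaining polynomial the roots have a sum that is large
  compared with \<open>sqrt X\<close>, so some root \<open>\<theta>\<close> is, and no second root can be of comparable size:
  \<open>\<theta>\<close> strictly dominates all other roots. Since the product of the roots has absolute value \<open>1\<close>,
  some root \<open>\<alpha>\<close> satisfies \<open>|\<alpha>| < 1\<close> (\<open>dominant_and_small_root\<close>). Different polynomials give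
  different \<open>\<alpha>\<close>.

  It remains to see that \<open>\<gamma> = f(\<alpha>)\<close> lies in \<open>U_m\<close> when \<open>\<alpha>\<close> has a dominant conjugate \<open>\<theta>\<close> with
  \<open>|\<theta>| \<ge> 2 A + 2\<close>, where \<open>A\<close> bounds the coefficients of \<open>f\<close> (\<open>value_in_U\<close>). Let \<open>g\<^sub>n\<close> be the section
  of \<open>f\<close> of degree at most \<open>s n\<close>, and \<open>\<beta>\<^sub>n = g\<^sub>n(\<alpha>)\<close>.

  \<^item> The value \<open>g\<^sub>n(\<theta>)\<close> is governed by its leading term. So it tends to infinity, and for large \<open>n\<close>
    it differs from \<open>g\<^sub>n(z)\<close> at all other conjugates \<open>z\<close>. A number of \<open>\<rat>(\<alpha>)\<close> of degree less than \<open>m\<close>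
    takes each of its conjugate values at least twice; hence \<open>\<beta>\<^sub>n\<close> has degree exactly \<open>m\<close>.

  \<^item> The height of \<open>\<beta>\<^sub>n\<close> is at most exponential in \<open>s n\<close>, whereas \<open>|\<gamma> - \<beta>\<^sub>n|\<close> is \<open>O(|\<alpha>|^(t n))\<close>
    because of the gap. As \<open>t n / s n\<close> tends to infinity, \<open>\<gamma>\<close> is well approximable in degree \<open>m\<close>.

  \<^item> If \<open>P\<close> is an integer polynomial with \<open>P(\<beta>\<^sub>n) \<noteq> 0\<close>, then the norm of \<open>P(\<beta>\<^sub>n)\<close> is a non-zero
    integer, and so \<open>P(\<beta>\<^sub>n)\<close> is not too small. Hence a zero of \<open>P\<close> close to \<open>\<gamma>\<close> keeps a certain distance
    (\<open>liouville_estimate\<close>). Taking for \<open>P\<close> an integer polynomial vanishing at \<open>\<gamma>\<close> gives transcendence. For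
    approximations of degree \<open>k < m\<close> and height \<open>H\<close>, one takes the first \<open>n\<close> with \<open>t n\<close> above a multiple
    of \<open>log H\<close>; boundedness of \<open>s (n + 1) / t n\<close> makes \<open>s n = O(log H)\<close>, and the estimate turns into a
    distance of at least a fixed negative power of \<open>H\<close>.
\<close>

hide_const (open) up_ring.coeff up_ring.monom Coset.order Module.smult

section \<open>Minimal polynomials over the integers\<close>

abbreviation ipoly :: "int poly \<Rightarrow> complex \<Rightarrow> complex" where
  "ipoly P z \<equiv> poly (of_int_poly P) z"

lemma poly_of_rat_of_int_poly: "poly (map_poly of_rat (of_int_poly P)) z = ipoly P z"
proof -
  have "map_poly of_rat (of_int_poly P :: rat poly) = (of_int_poly P :: complex poly)"
    by (rule poly_eqI) (simp add: coeff_map_poly)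
  thus ?thesis by simp
qed

lemma is_unit_int_poly: "(A :: int poly) dvd 1 \<Longrightarrow> A = 1 \<or> A = - 1"
proof -
  assume "A dvd 1"
  then obtain c where c: "A = [:c:]" "c dvd 1" unfolding is_unit_poly_iff by blast
  have "c = 1 \<or> c = - 1" using c(2) zdvd1_eq abs_eq_iff' by (metis abs_1 abs_eq_iff)
  thus ?thesis using c(1) by (metis minus_pCons minus_zero pCons_one)
qed

text \<open>
  If \<open>P\<close> does not divide \<open>Q\<close>, their greatest common divisor in \<open>\<int>[T]\<close> is \<open>1\<close>. By the lemma of Gauss
  it is then also \<open>1\<close> in \<open>\<rat>[T]\<close>, where a Bezout identity evaluated at the common root is absurd.
\<close>

lemma irreducible_dvd_common_root:
  assumes P: "irreducible P" and "ipoly P \<beta> = 0" and "ipoly Q \<beta> = 0"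
  shows "P dvd Q"
proof (rule ccontr)
  interpret rh: map_poly_comm_ring_hom "of_rat :: rat \<Rightarrow> complex" ..
  assume nd: "\<not> P dvd Q"
  have "gcd P Q dvd P" by simp
  moreover have "\<not> P dvd gcd P Q" using nd by auto
  ultimately have "gcd P Q dvd 1" using P by (meson irreducible_altdef)
  hence g: "gcd P Q = 1" by simp
  define G :: "rat poly" where "G = gcd (of_int_poly P) (of_int_poly Q)"
  have G: "G = [:1:]"
    unfolding G_def gcd_rat_to_gcd_int using g by simp
  obtain x y where "bezout_coefficients (of_int_poly P :: rat poly) (of_int_poly Q) = (x, y)"
    by force
  from bezout_coefficients[OF this] have "x * of_int_poly P + y * of_int_poly Q = G"
    by (simp add: G_def)
  hence "poly (map_poly of_rat (x * of_int_poly P + y * of_int_poly Q)) \<beta> = poly (map_poly of_rat G) \<beta>"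
    by simp
  also have "poly (map_poly of_rat (x * of_int_poly P + y * of_int_poly Q)) \<beta> = 0"
    using assms(2,3) by (simp add: rh.hom_add rh.hom_mult poly_of_rat_of_int_poly)
  finally show False using G by simp
qed

lemma degree_pos_of_irreducible_root:
  assumes P: "irreducible P" and "ipoly P \<beta> = 0"
  shows "degree P > 0"
proof (rule ccontr)
  assume "\<not> degree P > 0"
  then obtain c where c: "P = [:c:]" by (metis degree_0_id gr0I)
  have "c = 0" using assms(2) unfolding c of_int_hom.map_poly_pCons_hom by simp
  thus False using c P by simp
qed

lemma exists_irreducible_root:
  assumes "Q \<noteq> 0" "ipoly Q \<beta> = 0"
  shows "\<exists>P. irreducible P \<and> ipoly P \<beta> = 0"
  using assms
proof (induction Q rule: prime_divisors_induct)
  case (unit Q)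
  hence "Q = 1 \<or> Q = - 1" using is_unit_int_poly by blast
  thus ?case using unit by (auto simp: of_int_poly_hom.hom_uminus)
next
  case (factor p Q)
  have "irreducible p" using factor(1) by (intro prime_elem_imp_irreducible prime_imp_prime_elem)
  moreover have "Q \<noteq> 0" "ipoly p \<beta> = 0 \<or> ipoly Q \<beta> = 0"
    using factor.prems by (auto simp: of_int_poly_hom.hom_mult)
  ultimately show ?case using factor.IH by blast
qed auto

lemma algebraic_iff_ipoly: "algebraic \<beta> \<longleftrightarrow> (\<exists>Q. Q \<noteq> 0 \<and> ipoly Q \<beta> = 0)"
proof
  assume "algebraic \<beta>"
  then obtain p where "p \<noteq> 0" "poly (map_poly of_int p) \<beta> = 0" by (rule algebraicE')
  thus "\<exists>Q. Q \<noteq> 0 \<and> ipoly Q \<beta> = 0" by auto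
next
  assume "\<exists>Q. Q \<noteq> 0 \<and> ipoly Q \<beta> = 0"
  then obtain Q where "Q \<noteq> 0" "ipoly Q \<beta> = 0" by blast
  thus "algebraic \<beta>" by (intro algebraicI[of "of_int_poly Q"]) auto
qed

lemma int_min_poly:
  assumes "algebraic \<beta>"
  shows "irreducible (int_min_poly \<beta>)" and "ipoly (int_min_poly \<beta>) \<beta> = 0"
proof -
  have "\<exists>P. irreducible P \<and> ipoly P \<beta> = 0"
    using exists_irreducible_root assms unfolding algebraic_iff_ipoly by blast
  from someI_ex[OF this] show "irreducible (int_min_poly \<beta>)" "ipoly (int_min_poly \<beta>) \<beta> = 0"
    unfolding int_min_poly_def by simp_all
qed

lemma irreducible_common_root_eq:
  assumes "irreducible P" "ipoly P \<beta> = 0" "irreducible Q" "ipoly Q \<beta> = 0"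
  shows "P = Q \<or> P = - Q"
proof -
  have "Q dvd P" "P dvd Q" using assms irreducible_dvd_common_root by blast+
  then obtain A B where A: "P = Q * A" and B: "Q = P * B" unfolding dvd_def by blast
  have "Q * (A * B) = Q * 1" by (metis A B mult.assoc mult.right_neutral)
  moreover have "Q \<noteq> 0" using assms by auto
  ultimately have "A * B = 1" by (metis mult_cancel_left)
  hence "A dvd 1" by (metis dvd_triv_left)
  from is_unit_int_poly[OF this] show ?thesis by (elim disjE) (simp_all add: A)
qed

text \<open>
  This removes the choice in the definition of the minimal polynomial: degree and height of an
  algebraic number can be read off from any irreducible integer polynomial vanishing at it.
\<close>

lemma int_min_poly_eq:
  assumes "irreducible P" "ipoly P \<beta> = 0"
  shows "int_min_poly \<beta> = P \<or> int_min_poly \<beta> = - P"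
proof -
  have "P \<noteq> 0" using assms by auto
  hence "algebraic \<beta>" using assms algebraic_iff_ipoly by blast
  from int_min_poly[OF this] show ?thesis using irreducible_common_root_eq assms by blast
qed

lemma max_abs_coeff_uminus [simp]: "max_abs_coeff (- P) = max_abs_coeff P"
  by (simp add: max_abs_coeff_def)

lemma finite_abs_coeffs: "finite (range (\<lambda>i. \<bar>coeff (P :: int poly) i\<bar>))"
proof -
  have "range (\<lambda>i. \<bar>coeff P i\<bar>) \<subseteq> insert 0 ((\<lambda>i. \<bar>coeff P i\<bar>) ` {..degree P})"
  proof
    fix x assume "x \<in> range (\<lambda>i. \<bar>coeff P i\<bar>)"
    then obtain i where "x = \<bar>coeff P i\<bar>" by blast
    thus "x \<in> insert 0 ((\<lambda>i. \<bar>coeff P i\<bar>) ` {..degree P})"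
      by (cases "i \<le> degree P") (auto simp: coeff_eq_0)
  qed
  thus ?thesis by (rule finite_subset) auto
qed

lemma abs_coeff_le_max: "\<bar>coeff P i\<bar> \<le> max_abs_coeff P"
  unfolding max_abs_coeff_def by (rule Max_ge[OF finite_abs_coeffs]) auto

lemma max_abs_coeff_le: "(\<And>i. \<bar>coeff P i\<bar> \<le> H) \<Longrightarrow> max_abs_coeff P \<le> H"
  unfolding max_abs_coeff_def by (subst Max_le_iff[OF finite_abs_coeffs]) auto

lemma max_abs_coeff_ge_1: "P \<noteq> 0 \<Longrightarrow> max_abs_coeff P \<ge> 1"
  using abs_coeff_le_max[of P "degree P"] leading_coeff_0_iff[of P] by linarith

text \<open>
  The rational polynomial of least degree may be taken with integer coefficients after clearing
  denominators, and then \<open>P\<close> divides it.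
\<close>

lemma algebraic_degree_eq:
  assumes P: "irreducible P" "ipoly P \<beta> = 0"
  shows "algebraic_degree \<beta> = degree P"
  unfolding algebraic_degree_def
proof (rule Least_equality)
  show "\<exists>p :: rat poly. p \<noteq> 0 \<and> degree p = degree P \<and> poly (map_poly of_rat p) \<beta> = 0"
    using assms by (intro exI[of _ "of_int_poly P"]) (auto simp: poly_of_rat_of_int_poly)
next
  fix n
  assume "\<exists>p :: rat poly. p \<noteq> 0 \<and> degree p = n \<and> poly (map_poly of_rat p) \<beta> = 0"
  then obtain p :: "rat poly" where p: "p \<noteq> 0" "degree p = n" "poly (map_poly of_rat p) \<beta> = 0" by auto
  interpret rh: map_poly_comm_ring_hom "of_rat :: rat \<Rightarrow> complex" ..
  obtain d q where "rat_to_normalized_int_poly p = (d, q)" by force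
  note q = rat_to_normalized_int_poly[OF this]
  have "of_rat d * ipoly q \<beta> = poly (map_poly of_rat (smult d (of_int_poly q))) \<beta>"
    by (simp add: of_rat_hom.map_poly_hom_smult poly_of_rat_of_int_poly)
  hence "ipoly q \<beta> = 0" using q(1,2) p(3) by simp
  hence "P dvd q" using P irreducible_dvd_common_root by blast
  moreover have "q \<noteq> 0" using q(1) p(1) by auto
  ultimately have "degree P \<le> degree q" by (rule dvd_imp_degree_le)
  thus "degree P \<le> n" using q(4) p(2) by simp
qed

lemma algebraic_degree_int_min_poly:
  "algebraic \<beta> \<Longrightarrow> algebraic_degree \<beta> = degree (int_min_poly \<beta>)"
  using algebraic_degree_eq int_min_poly by blast

text \<open>
  The property of Northcott: approximations that violate an inequality valid for all large heights
  can only be finite in number.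
\<close>

lemma finite_algebraic_bounded:
  "finite {\<beta>. algebraic \<beta> \<and> algebraic_degree \<beta> = k \<and> max_abs_coeff (int_min_poly \<beta>) \<le> H}"
proof (rule finite_subset)
  let ?F = "{P :: int poly. degree P \<le> k \<and> P \<noteq> 0 \<and> (\<forall>i. \<bar>coeff P i\<bar> \<le> H)}"
  have "finite ?F"
  proof (rule finite_subset)
    show "?F \<subseteq> Poly ` {xs. set xs \<subseteq> {-H..H} \<and> length xs \<le> Suc k}"
    proof
      fix P assume P: "P \<in> ?F"
      have "set (coeffs P) \<subseteq> {-H..H}"
        using P by (auto simp: in_set_conv_nth nth_coeffs_coeff abs_le_iff length_coeffs_degree minus_le_iff)
      thus "P \<in> Poly ` {xs. set xs \<subseteq> {-H..H} \<and> length xs \<le> Suc k}"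
        using P by (intro image_eqI[of _ _ "coeffs P"]) (auto simp: length_coeffs_degree)
    qed
  qed (intro finite_imageI finite_lists_length_le, auto)
  moreover have "finite {z. ipoly P z = 0}" if "P \<in> ?F" for P
    using that by (intro poly_roots_finite) auto
  ultimately show "finite (\<Union>P\<in>?F. {z. ipoly P z = 0})" by blast
  show "{\<beta>. algebraic \<beta> \<and> algebraic_degree \<beta> = k \<and> max_abs_coeff (int_min_poly \<beta>) \<le> H}
      \<subseteq> (\<Union>P\<in>?F. {z. ipoly P z = 0})"
  proof
    fix \<beta> assume b: "\<beta> \<in> {\<beta>. algebraic \<beta> \<and> algebraic_degree \<beta> = k \<and> max_abs_coeff (int_min_poly \<beta>) \<le> H}"
    hence "int_min_poly \<beta> \<in> ?F"
      using algebraic_degree_int_min_poly abs_coeff_le_max order_trans int_min_poly(1) by fastforce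
    thus "\<beta> \<in> (\<Union>P\<in>?F. {z. ipoly P z = 0})" using b int_min_poly(2) by blast
  qed
qed

section \<open>The characteristic polynomial of a value at the conjugates\<close>

lemma ipoly_roots_simple:
  assumes M: "irreducible M" and "ipoly M z = 0"
  shows "ipoly (pderiv M) z \<noteq> 0"
proof
  assume "ipoly (pderiv M) z = 0"
  hence d: "M dvd pderiv M" using assms irreducible_dvd_common_root by blast
  have deg: "degree M > 0" using assms degree_pos_of_irreducible_root by blast
  have "pderiv M \<noteq> 0" using deg by (simp add: pderiv_eq_0_iff)
  hence "degree M \<le> degree (pderiv M)" using d dvd_imp_degree_le by blast
  thus False using deg by (simp add: degree_pderiv)
qed

lemma monic_irreducible_roots:
  assumes M: "irreducible M" "lead_coeff M = 1"
  shows "finite {z. ipoly M z = 0}" and "card {z. ipoly M z = 0} = degree M"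
    and "of_int_poly M = (\<Prod>z | ipoly M z = 0. [:- z, 1:])"
proof -
  let ?p = "of_int_poly M :: complex poly"
  have nz: "?p \<noteq> 0" using M by auto
  show fin: "finite {z. ipoly M z = 0}" using nz by (rule poly_roots_finite)
  have "rsquarefree ?p"
    unfolding rsquarefree_roots
    using ipoly_roots_simple[OF M(1)] by (auto simp: of_int_hom.map_poly_pderiv)
  hence ord: "order z ?p = 1" if "ipoly M z = 0" for z
    using that nz unfolding rsquarefree_def by (metis order_root)
  have "?p = smult (lead_coeff ?p) (\<Prod>z | ipoly M z = 0. [:- z, 1:] ^ order z ?p)"
    using complex_poly_decompose[of ?p] by simp
  also have "\<dots> = (\<Prod>z | ipoly M z = 0. [:- z, 1:])"
    using ord M(2) by (simp cong: prod.cong_simp)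
  finally show *: "?p = (\<Prod>z | ipoly M z = 0. [:- z, 1:])" .
  have "degree M = degree ?p" by simp
  also have "\<dots> = degree (\<Prod>z | ipoly M z = 0. [:- z, 1:])" using * by (rule arg_cong)
  also have "\<dots> = (\<Sum>z | ipoly M z = 0. degree [:- z, 1:])"
    by (rule degree_prod_eq_sum_degree) auto
  finally show "card {z. ipoly M z = 0} = degree M" by simp
qed

lemma ipoly_pcompose: "ipoly (pcompose P g) z = ipoly P (ipoly g z)"
  by (simp add: of_int_hom.map_poly_pcompose poly_pcompose)

text \<open>
  Multiplication by \<open>g(z)\<close> maps \<open>1, z, \<dots>, z^(m - 1)\<close> to integer combinations of these powers, with the
  same integer matrix \<open>A\<close> for every root \<open>z\<close> of \<open>M\<close>: row \<open>i\<close> consists of the coefficients of the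
  remainder of \<open>T^i g\<close> modulo \<open>M\<close>. So the columns \<open>(1, z, \<dots>, z^(m - 1))\<close> of the Vandermonde matrix \<open>V\<close>
  are eigenvectors of \<open>A\<close> with eigenvalues \<open>g(z)\<close>. As the roots are distinct, \<open>V\<close> is invertible, and
  the characteristic polynomial of \<open>A\<close> has the stated roots.
\<close>

lemma char_poly_of_conjugates:
  assumes M: "irreducible M" "lead_coeff M = 1"
  shows "\<exists>\<Phi>. lead_coeff \<Phi> = 1 \<and> degree \<Phi> = degree M \<and>
    of_int_poly \<Phi> = (\<Prod>z | ipoly M z = 0. [:- ipoly g z, 1:])"
proof (cases "degree M = 0")
  case True
  hence "{z. ipoly M z = 0} = {}" using monic_irreducible_roots[OF M] by simp
  thus ?thesis using True by (intro exI[of _ 1]) simp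
next
  case False
  let ?Z = "{z. ipoly M z = 0}" and ?m = "degree M"
  have M0: "M \<noteq> 0" using M by auto
  obtain zs where zs: "set zs = ?Z" "distinct zs"
    using finite_distinct_list monic_irreducible_roots(1)[OF M] by blast
  have len: "length zs = ?m"
    using distinct_card[OF zs(2)] zs(1) monic_irreducible_roots(2)[OF M] by simp
  have root: "ipoly M (zs ! k) = 0" if "k < ?m" for k
    using nth_mem[of k zs] that by (simp add: zs(1) len)
  have "\<exists>r. degree r < ?m \<and> (\<forall>z. ipoly M z = 0 \<longrightarrow> z ^ i * ipoly g z = ipoly r z)" for i
  proof -
    obtain q r where qr: "pseudo_divmod (monom 1 i * g) M = (q, r)" by force
    from pseudo_divmod[OF M0 qr] have *: "monom 1 i * g = M * q + r" "r = 0 \<or> degree r < ?m"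
      using M(2) by auto
    have "z ^ i * ipoly g z = ipoly r z" if z: "ipoly M z = 0" for z
    proof -
      have "ipoly (monom 1 i * g) z = ipoly (M * q + r) z" using *(1) by simp
      thus ?thesis using z
        by (simp add: of_int_poly_hom.hom_mult of_int_poly_hom.hom_add map_poly_monom poly_monom)
    qed
    moreover have "degree r < ?m" using *(2) False by auto
    ultimately show ?thesis by blast
  qed
  then obtain r where r: "\<And>i. degree (r i) < ?m" "\<And>i z. ipoly M z = 0 \<Longrightarrow> z ^ i * ipoly g z = ipoly (r i) z"
    by metis
  define A where "A = mat ?m ?m (\<lambda>(i,j). coeff (r i) j)"
  define V where "V = mat ?m ?m (\<lambda>(i,k). (zs ! k) ^ i)"
  define D where "D = mat ?m ?m (\<lambda>(i,k). if i = k then ipoly g (zs ! k) else 0)"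
  have carr: "A \<in> carrier_mat ?m ?m" "V \<in> carrier_mat ?m ?m" "D \<in> carrier_mat ?m ?m"
    by (auto simp: A_def V_def D_def)
  let ?A = "map_mat complex_of_int A"
  have cA: "?A \<in> carrier_mat ?m ?m" using carr by simp
  have AV: "?A * V = V * D"
  proof (rule eq_matI)
    fix i k assume "i < dim_row (V * D)" "k < dim_col (V * D)"
    hence ik: "i < ?m" "k < ?m" using carr by auto
    have "(?A * V) $$ (i, k) = (\<Sum>j<?m. of_int (coeff (r i) j) * (zs ! k) ^ j)"
      using ik carr by (simp add: scalar_prod_def A_def V_def atLeast0LessThan)
    also have "\<dots> = (\<Sum>j\<le>degree (r i). of_int (coeff (r i) j) * (zs ! k) ^ j)"
      using r(1)[of i] by (intro sum.mono_neutral_right) (auto simp: coeff_eq_0)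
    also have "\<dots> = ipoly (r i) (zs ! k)"
      by (simp add: poly_altdef)
    also have "\<dots> = (zs ! k) ^ i * ipoly g (zs ! k)" using r(2)[OF root[OF ik(2)]] by simp
    also have "\<dots> = (\<Sum>j<?m. (zs ! j) ^ i * (if j = k then ipoly g (zs ! k) else 0))"
      using ik(2) by (simp add: if_distrib[of "\<lambda>x. _ * x"] cong: if_cong)
    also have "\<dots> = (V * D) $$ (i, k)"
      using ik carr by (simp add: scalar_prod_def D_def V_def atLeast0LessThan)
    finally show "(?A * V) $$ (i, k) = (V * D) $$ (i, k)" .
  qed (use carr in auto)
  \<comment> \<open>A kernel vector of the transpose would be a polynomial of degree below m with m roots.\<close>
  have "Determinant.det (transpose_mat V) \<noteq> 0"
  proof
    assume "Determinant.det (transpose_mat V) = 0"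
    then obtain v where v: "v \<in> carrier_vec ?m" "v \<noteq> 0\<^sub>v ?m" "transpose_mat V *\<^sub>v v = 0\<^sub>v ?m"
      using det_0_iff_vec_prod_zero[of "transpose_mat V" ?m] carr by auto
    define p where "p = (\<Sum>i<?m. monom (vec_index v i) i)"
    have cp: "coeff p i = (if i < ?m then vec_index v i else 0)" for i
      by (simp add: p_def coeff_sum if_distrib[of "\<lambda>f. f _"] sum.delta' cong: if_cong)
    have "p \<noteq> 0"
    proof
      assume "p = 0"
      hence "vec_index v i = 0" if "i < ?m" for i using cp[of i] that by simp
      hence "v = 0\<^sub>v ?m" using v(1) by (intro eq_vecI) auto
      thus False using v(2) by simp
    qed
    have "poly p z = 0" if z: "z \<in> ?Z" for z
    proof -
      obtain k where k: "k < ?m" "z = zs ! k" using z unfolding zs(1)[symmetric] in_set_conv_nth len by blast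
      have "poly p z = (\<Sum>i<?m. (zs ! k) ^ i * vec_index v i)"
        by (simp add: p_def poly_sum poly_monom k(2) mult.commute)
      also have "\<dots> = vec_index (transpose_mat V *\<^sub>v v) k"
        using k(1) carr v(1) by (simp add: scalar_prod_def V_def atLeast0LessThan)
      finally show ?thesis using v(3) k(1) by simp
    qed
    hence "?Z \<subseteq> {z. poly p z = 0}" by blast
    hence "?m \<le> card {z. poly p z = 0}"
      using monic_irreducible_roots(2)[OF M] card_mono[OF poly_roots_finite[OF \<open>p \<noteq> 0\<close>]] by metis
    also have "\<dots> \<le> degree p" using poly_roots_degree[OF \<open>p \<noteq> 0\<close>] .
    finally have "?m \<le> degree p" .
    moreover have "degree p \<le> ?m - 1" by (rule degree_le) (auto simp: cp)
    ultimately show False using False by linarith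
  qed
  hence "Determinant.det V \<noteq> 0" using det_transpose[OF carr(2)] by simp
  from det_non_zero_imp_unit[OF carr(2) this, unfolded Units_def, of "()"]
  obtain W where cW: "W \<in> carrier_mat ?m ?m" and WV: "W * V = 1\<^sub>m ?m" "V * W = 1\<^sub>m ?m"
    by (auto simp: ring_mat_def)
  have "?A = ?A * (V * W)" using WV cA by simp
  also have "\<dots> = V * D * W" using AV cA carr cW by (metis assoc_mult_mat)
  finally have "similar_mat ?A D"
    unfolding similar_mat_def similar_mat_wit_def Let_def using WV cA carr cW
    by (intro exI[of _ V] exI[of _ W]) auto
  hence 1: "char_poly ?A = char_poly D" by (rule char_poly_similar)
  have "upper_triangular D" by (auto simp: D_def)
  from char_poly_upper_triangular[OF carr(3) this]
  have 2: "char_poly D = prod_list (map (\<lambda>a. [:- a, 1:]) (diag_mat D))" .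
  have 3: "diag_mat D = map (ipoly g) zs"
    by (rule nth_equalityI) (auto simp: diag_mat_def D_def len)
  have 4: "prod_list (map (\<lambda>z. [:- ipoly g z, 1:]) zs) = (\<Prod>z\<in>?Z. [:- ipoly g z, 1:])"
    using prod.distinct_set_conv_list[OF zs(2), of "\<lambda>z. [:- ipoly g z, 1:]"] unfolding zs(1) by (rule sym)
  have "of_int_poly (char_poly A) = (\<Prod>z\<in>?Z. [:- ipoly g z, 1:])"
    unfolding of_int_hom.char_poly_hom[OF carr(1), symmetric] 1 2 3 4[symmetric] by (simp add: o_def)
  thus ?thesis using degree_monic_char_poly[OF carr(1)] by (intro exI[of _ "char_poly A"]) simp
qed

section \<open>Norms and degrees of values at conjugates\<close>

lemma root_at_conjugates:
  assumes "irreducible M" "ipoly M \<alpha> = 0" "ipoly Q \<alpha> = 0" "ipoly M z = 0"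
  shows "ipoly Q z = 0"
proof -
  have "M dvd Q" using assms irreducible_dvd_common_root by blast
  then obtain A where "Q = M * A" by (rule dvdE)
  thus ?thesis using assms(4) by (simp add: of_int_poly_hom.hom_mult)
qed

text \<open>
  The product of \<open>h(z)\<close> over all conjugates \<open>z\<close> of \<open>\<alpha>\<close> is, up to sign, the constant coefficient of an
  integer polynomial. It does not vanish, so its absolute value is at least \<open>1\<close>.
\<close>

lemma norm_lower_bound:
  assumes M: "irreducible M" "lead_coeff M = 1" and \<alpha>: "ipoly M \<alpha> = 0"
    and h: "ipoly h \<alpha> \<noteq> 0" and L: "\<And>z. ipoly M z = 0 \<Longrightarrow> cmod (ipoly h z) \<le> L"
  shows "1 \<le> cmod (ipoly h \<alpha>) * L ^ (degree M - 1)"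
proof -
  let ?Z = "{z. ipoly M z = 0}"
  note fin = monic_irreducible_roots(1)[OF M]
  obtain \<Phi> where \<Phi>: "of_int_poly \<Phi> = (\<Prod>z\<in>?Z. [:- ipoly h z, 1:])"
    using char_poly_of_conjugates[OF M] by blast
  have "cmod (of_int (coeff \<Phi> 0)) = cmod (poly (of_int_poly \<Phi>) 0)"
    by (simp add: poly_0_coeff_0)
  also have "\<dots> = cmod (\<Prod>z\<in>?Z. - ipoly h z)" unfolding \<Phi> by (simp add: poly_prod)
  also have "\<dots> = (\<Prod>z\<in>?Z. cmod (ipoly h z))" by (simp flip: prod_norm)
  finally have eq: "real_of_int \<bar>coeff \<Phi> 0\<bar> = (\<Prod>z\<in>?Z. cmod (ipoly h z))" by simp
  have "ipoly h z \<noteq> 0" if "z \<in> ?Z" for z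
    using that root_at_conjugates[OF M(1) _ _ \<alpha>] h by blast
  hence "(\<Prod>z\<in>?Z. cmod (ipoly h z)) \<noteq> 0" using fin by simp
  hence "coeff \<Phi> 0 \<noteq> 0" using eq by auto
  hence "1 \<le> (\<Prod>z\<in>?Z. cmod (ipoly h z))" unfolding eq[symmetric] by linarith
  also have "\<dots> = cmod (ipoly h \<alpha>) * (\<Prod>z\<in>?Z - {\<alpha>}. cmod (ipoly h z))"
    by (rule prod.remove) (use fin \<alpha> in auto)
  also have "\<dots> \<le> cmod (ipoly h \<alpha>) * (\<Prod>z\<in>?Z - {\<alpha>}. L)"
    by (intro mult_left_mono prod_mono) (use L in auto)
  also have "(\<Prod>z\<in>?Z - {\<alpha>}. L) = L ^ (degree M - 1)"
    using fin \<alpha> monic_irreducible_roots(2)[OF M] by simp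
  finally show ?thesis .
qed

text \<open>
  A simple root of the characteristic polynomial \<open>\<Phi>\<close> of \<open>g(\<alpha>)\<close> forces \<open>\<Phi>\<close> to be irreducible. Let \<open>P\<close> be
  the minimal polynomial of \<open>g(\<alpha>)\<close>; it vanishes at all \<open>g(z)\<close>. If the cofactor of \<open>P\<close> in \<open>\<Phi>\<close> had a root,
  this root would be some \<open>g(z)\<close>, so \<open>P\<close> would divide \<open>\<Phi>\<close> twice, and \<open>g(\<theta>)\<close> would be a multiple root.
  It suffices that a single conjugate \<open>\<theta>\<close> has a value different from the others, and \<open>\<theta>\<close> need not be
  \<open>\<alpha>\<close> itself.
\<close>

lemma min_poly_of_conjugate_separating:
  assumes M: "irreducible M" "lead_coeff M = 1" and \<alpha>: "ipoly M \<alpha> = 0" and \<theta>: "ipoly M \<theta> = 0"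
    and sep: "\<And>z. ipoly M z = 0 \<Longrightarrow> z \<noteq> \<theta> \<Longrightarrow> ipoly g z \<noteq> ipoly g \<theta>"
  shows "\<exists>\<Phi>. irreducible \<Phi> \<and> lead_coeff \<Phi> = 1 \<and> degree \<Phi> = degree M \<and> ipoly \<Phi> (ipoly g \<alpha>) = 0 \<and>
    of_int_poly \<Phi> = (\<Prod>z | ipoly M z = 0. [:- ipoly g z, 1:])"
proof -
  let ?Z = "{z. ipoly M z = 0}"
  note fin = monic_irreducible_roots(1)[OF M]
  obtain \<Phi> where \<Phi>: "lead_coeff \<Phi> = 1" "degree \<Phi> = degree M"
      "of_int_poly \<Phi> = (\<Prod>z\<in>?Z. [:- ipoly g z, 1:])"
    using char_poly_of_conjugates[OF M] by blast
  have ev: "ipoly \<Phi> w = (\<Prod>z\<in>?Z. w - ipoly g z)" for w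
    unfolding \<Phi>(3) by (simp add: poly_prod)
  have root: "ipoly \<Phi> (ipoly g \<alpha>) = 0" unfolding ev using fin \<alpha> by (auto intro!: prod_zero)
  have \<Phi>0: "\<Phi> \<noteq> 0" using \<Phi>(1) by auto
  obtain P where P: "irreducible P" "ipoly P (ipoly g \<alpha>) = 0"
    using exists_irreducible_root[OF \<Phi>0 root] by blast
  have Pg: "ipoly P (ipoly g z) = 0" if "z \<in> ?Z" for z
    using root_at_conjugates[OF M(1) \<alpha>, of "pcompose P g" z] that P(2) by (simp add: ipoly_pcompose)
  obtain Q where Q: "\<Phi> = P * Q" using irreducible_dvd_common_root[OF P root] by (rule dvdE)
  have lc: "lead_coeff P * lead_coeff Q = 1" using Q \<Phi>(1) lead_coeff_mult by metis
  have "degree Q = 0"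
  proof (rule ccontr)
    assume "degree Q \<noteq> 0"
    hence "\<not> constant (poly (of_int_poly Q :: complex poly))" by (simp add: constant_degree)
    then obtain w where w: "ipoly Q w = 0" using fundamental_theorem_of_algebra by blast
    hence "ipoly \<Phi> w = 0" unfolding Q by (simp add: of_int_poly_hom.hom_mult)
    then obtain z where z: "z \<in> ?Z" "w = ipoly g z" unfolding ev using fin by auto
    have "P dvd Q" using irreducible_dvd_common_root[OF P(1)] Pg[OF z(1)] w z(2) by blast
    then obtain R where R: "Q = P * R" by (rule dvdE)
    let ?t = "ipoly g \<theta>"
    have Pt: "ipoly P ?t = 0" using Pg \<theta> by blast
    have "ipoly (pderiv \<Phi>) ?t = 0" unfolding Q R using Pt
      by (simp add: pderiv_mult of_int_poly_hom.hom_mult of_int_poly_hom.hom_add)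
    moreover have "of_int_poly \<Phi> = [:- ?t, 1:] * (\<Prod>z\<in>?Z - {\<theta>}. [:- ipoly g z, 1:])"
      unfolding \<Phi>(3) by (rule prod.remove) (use fin \<theta> in auto)
    hence "pderiv (of_int_poly \<Phi>) = pderiv ([:- ?t, 1:] * (\<Prod>z\<in>?Z - {\<theta>}. [:- ipoly g z, 1:]))"
      by (rule arg_cong)
    hence "poly (pderiv (of_int_poly \<Phi>)) ?t = (\<Prod>z\<in>?Z - {\<theta>}. ?t - ipoly g z)"
      unfolding pderiv_mult by (simp add: pderiv_pCons poly_prod)
    ultimately have "(\<Prod>z\<in>?Z - {\<theta>}. ?t - ipoly g z) = 0" by (simp add: of_int_hom.map_poly_pderiv)
    then obtain z where "z \<in> ?Z - {\<theta>}" "?t = ipoly g z" using fin by auto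
    thus False using sep[of z] by auto
  qed
  then obtain c where c: "Q = [:c:]" by (metis degree_0_id)
  hence "Q dvd 1" using lc by (metis dvd_triv_right is_unit_const_poly_iff lead_coeff_pCons(2) lead_coeff_1 coeff_pCons_0 degree_pCons_0)
  hence "irreducible \<Phi>" unfolding Q using P(1) by (simp add: irreducible_mult_unit_right)
  thus ?thesis using \<Phi> root by blast
qed

text \<open>
  This bounds the height of \<open>\<beta>\<^sub>n\<close> by means of the sizes of its conjugates.
\<close>

lemma norm_coeff_prod_linear_le:
  fixes w :: "'a \<Rightarrow> complex"
  assumes "finite S"
  shows "cmod (coeff (\<Prod>z\<in>S. [:- w z, 1:]) i) \<le> (\<Prod>z\<in>S. 1 + cmod (w z))"
  using assms
proof (induction S arbitrary: i rule: finite_induct)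
  case empty
  show ?case by (cases i) auto
next
  case (insert x S)
  let ?p = "\<Prod>z\<in>S. [:- w z, 1:]"
  have "coeff (\<Prod>z\<in>insert x S. [:- w z, 1:]) i = (case i of 0 \<Rightarrow> 0 | Suc j \<Rightarrow> coeff ?p j) - w x * coeff ?p i"
    using insert.hyps by (simp add: coeff_pCons split: nat.split)
  also have "cmod \<dots> \<le> cmod (case i of 0 \<Rightarrow> 0 | Suc j \<Rightarrow> coeff ?p j) + cmod (w x) * cmod (coeff ?p i)"
    unfolding norm_mult[symmetric] by (rule norm_triangle_ineq4)
  also have "\<dots> \<le> (\<Prod>z\<in>S. 1 + cmod (w z)) + cmod (w x) * (\<Prod>z\<in>S. 1 + cmod (w z))"
    using insert.IH by (intro add_mono mult_left_mono) (auto split: nat.split intro!: prod_nonneg)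
  also have "\<dots> = (\<Prod>z\<in>insert x S. 1 + cmod (w z))"
    using insert.hyps by (simp add: algebra_simps)
  finally show ?case .
qed

lemma coeff_prod_linear_next_to_leading:
  fixes S :: "complex set"
  assumes "finite S" "S \<noteq> {}"
  shows "coeff (\<Prod>z\<in>S. [:- z, 1:]) (card S - 1) = - \<Sum>S"
  using assms
proof (induction S rule: finite_ne_induct)
  case (insert x S)
  let ?p = "\<Prod>z\<in>S. [:- z, 1:]"
  have deg: "degree ?p = card S"
    by (subst degree_prod_eq_sum_degree) auto
  have "lead_coeff ?p = (\<Prod>z\<in>S. lead_coeff [:- z, 1:])" by (rule lead_coeff_prod)
  hence lc: "coeff ?p (card S) = 1" using deg by simp
  obtain k where k: "card S = Suc k" using insert.hyps by (metis card_0_eq not0_implies_Suc)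
  show ?case using insert.hyps insert.IH lc k by (simp add: coeff_pCons)
qed simp

section \<open>Sizes of polynomial values and sections of power series\<close>

lemma norm_ipoly_le:
  assumes "\<And>i. \<bar>real_of_int (coeff P i)\<bar> \<le> A" "degree P \<le> N" "1 \<le> R" "cmod z \<le> R"
  shows "cmod (ipoly P z) \<le> A * (N + 1) * R ^ N"
proof -
  have "cmod (ipoly P z) \<le> (\<Sum>i\<le>degree P. cmod (of_int (coeff P i) * z ^ i))"
    by (simp add: poly_altdef norm_sum)
  also have "\<dots> \<le> (\<Sum>i\<le>degree P. A * R ^ N)"
  proof (rule sum_mono)
    fix i assume "i \<in> {..degree P}"
    hence "i \<le> N" using assms(2) by simp
    have "cmod z ^ i \<le> R ^ i" using assms(4) by (simp add: power_mono)
    also have "\<dots> \<le> R ^ N" using \<open>i \<le> N\<close> assms(3) by (rule power_increasing)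
    finally show "cmod (of_int (coeff P i) * z ^ i) \<le> A * R ^ N"
      using assms(1)[of i] unfolding norm_mult norm_power by (intro mult_mono) auto
  qed
  also have "\<dots> = (degree P + 1) * (A * R ^ N)" by simp
  also have "\<dots> \<le> (N + 1) * (A * R ^ N)"
    using assms(1)[of 0] assms(2,3) by (intro mult_right_mono) auto
  finally show ?thesis by (simp add: algebra_simps)
qed

lemma norm_ipoly_diff_le:
  assumes "\<And>i. \<bar>real_of_int (coeff P i)\<bar> \<le> H" "degree P \<le> k" "1 \<le> R" "cmod x \<le> R" "cmod y \<le> R"
  shows "cmod (ipoly P x - ipoly P y) \<le> H * (k + 1) * k * R ^ k * cmod (x - y)"
proof -
  have "ipoly P x - ipoly P y = (\<Sum>i\<le>degree P. of_int (coeff P i) * (x ^ i - y ^ i))"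
    by (simp add: poly_altdef sum_subtractf algebra_simps)
  also have "cmod \<dots> \<le> (\<Sum>i\<le>degree P. cmod (of_int (coeff P i) * (x ^ i - y ^ i)))"
    by (rule norm_sum)
  also have "\<dots> \<le> (\<Sum>i\<le>degree P. H * (k * R ^ k * cmod (x - y)))"
  proof (rule sum_mono)
    fix i assume "i \<in> {..degree P}"
    hence ik: "i \<le> k" using assms(2) by simp
    have "cmod ((x / R) ^ i - (y / R) ^ i) \<le> i * cmod (x / R - y / R)"
      by (rule norm_power_diff) (use assms in \<open>auto simp: norm_divide\<close>)
    also have "(x / R) ^ i - (y / R) ^ i = (x ^ i - y ^ i) / of_real (R ^ i)"
      by (simp add: power_divide diff_divide_distrib)
    also have "x / R - y / R = (x - y) / of_real R" by (simp add: diff_divide_distrib)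
    finally have "cmod (x ^ i - y ^ i) / R ^ i \<le> i * (cmod (x - y) / R)"
      using assms(3) by (simp add: norm_divide norm_power)
    also have "\<dots> \<le> i * cmod (x - y)"
      using assms(3) by (intro mult_left_mono) (auto simp: divide_le_eq mult_le_cancel_left1)
    finally have "cmod (x ^ i - y ^ i) \<le> i * cmod (x - y) * R ^ i"
      using assms(3) by (simp add: divide_le_eq)
    also have "\<dots> \<le> k * cmod (x - y) * R ^ k"
      using ik assms(3) by (intro mult_mono power_increasing) auto
    finally show "cmod (of_int (coeff P i) * (x ^ i - y ^ i)) \<le> H * (k * R ^ k * cmod (x - y))"
      using assms(1)[of i] unfolding norm_mult by (intro mult_mono) (auto simp: algebra_simps)
  qed
  also have "\<dots> = (degree P + 1) * (H * (k * R ^ k * cmod (x - y)))" by simp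
  also have "\<dots> \<le> (k + 1) * (H * (k * R ^ k * cmod (x - y)))"
    using assms(1)[of 0] assms(2,3) by (intro mult_right_mono) auto
  finally show ?thesis by (simp add: algebra_simps)
qed

text \<open>
  For \<open>|z| \<ge> 2 A + 2\<close> the lower terms contribute at most \<open>A |z|^d / (|z| - 1)\<close>, which is less than half of
  the leading term \<open>|z|^d\<close>.
\<close>

lemma norm_ipoly_ge:
  assumes "\<And>i. \<bar>real_of_int (coeff P i)\<bar> \<le> A" "1 \<le> A" "P \<noteq> 0" "2 * A + 2 \<le> cmod z"
  shows "cmod z ^ degree P / 2 \<le> cmod (ipoly P z)"
proof -
  let ?d = "degree P" and ?x = "cmod z"
  have "ipoly P z = of_int (lead_coeff P) * z ^ ?d + (\<Sum>i<?d. of_int (coeff P i) * z ^ i)"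
    by (simp add: poly_altdef lessThan_Suc_atMost[symmetric])
  hence "cmod (of_int (lead_coeff P) * z ^ ?d) - cmod (\<Sum>i<?d. of_int (coeff P i) * z ^ i) \<le> cmod (ipoly P z)"
    using norm_diff_ineq by metis
  moreover have "1 \<le> \<bar>lead_coeff P\<bar>" using assms(3) leading_coeff_0_iff[of P] by linarith
  hence "1 \<le> \<bar>real_of_int (lead_coeff P)\<bar>" by linarith
  hence "1 * ?x ^ ?d \<le> \<bar>real_of_int (lead_coeff P)\<bar> * ?x ^ ?d" by (intro mult_right_mono) auto
  hence "?x ^ ?d \<le> cmod (of_int (lead_coeff P) * z ^ ?d)"
    by (simp add: norm_mult norm_power)
  moreover have "cmod (\<Sum>i<?d. of_int (coeff P i) * z ^ i) \<le> ?x ^ ?d / 2"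
  proof -
    have "cmod (\<Sum>i<?d. of_int (coeff P i) * z ^ i) \<le> (\<Sum>i<?d. A * ?x ^ i)"
      using assms(1) by (intro sum_norm_le) (auto simp: norm_mult norm_power intro!: mult_right_mono)
    also have "\<dots> = A * ((?x ^ ?d - 1) / (?x - 1))"
      using assms(2,4) unfolding sum_distrib_left[symmetric] by (subst geometric_sum) auto
    also have "\<dots> \<le> A * (?x ^ ?d / (2 * A))"
      using assms(2,4) by (intro mult_left_mono frac_le) auto
    also have "\<dots> = ?x ^ ?d / 2" using assms(2) by simp
    finally show ?thesis .
  qed
  ultimately show ?thesis by linarith
qed

lemma norm_ipoly_le_geometric:
  assumes "\<And>i. \<bar>real_of_int (coeff P i)\<bar> \<le> A" "2 \<le> R" "cmod z \<le> R"
  shows "cmod (ipoly P z) \<le> 2 * A * R ^ degree P"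
proof -
  have "cmod (ipoly P z) \<le> (\<Sum>i\<le>degree P. A * R ^ i)"
    unfolding poly_altdef of_int_hom.degree_map_poly_hom
  proof (rule sum_norm_le)
    fix i
    show "cmod (coeff (of_int_poly P) i * z ^ i) \<le> A * R ^ i"
      using assms(1)[of i] assms(2,3) unfolding norm_mult norm_power
      by (intro mult_mono power_mono) auto
  qed
  also have "\<dots> = A * ((R ^ Suc (degree P) - 1) / (R - 1))"
    using assms(2) unfolding sum_distrib_left[symmetric] lessThan_Suc_atMost[symmetric]
    by (subst geometric_sum) auto
  also have "\<dots> \<le> A * (2 * R ^ degree P)"
  proof -
    have "R ^ degree P * 2 \<le> R ^ degree P * R" using assms(2) by (intro mult_left_mono) auto
    hence "R ^ Suc (degree P) - 1 \<le> 2 * R ^ degree P * (R - 1)"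
      by (simp add: algebra_simps)
    hence "(R ^ Suc (degree P) - 1) / (R - 1) \<le> 2 * R ^ degree P"
      using assms(2) by (subst pos_divide_le_eq) auto
    moreover have "0 \<le> A" using assms(1)[of 0] by simp
    ultimately show ?thesis by (rule mult_left_mono)
  qed
  finally show ?thesis by simp
qed

definition fps_section :: "int fps \<Rightarrow> nat \<Rightarrow> int poly" where
  "fps_section f N = (\<Sum>k\<le>N. monom (fps_nth f k) k)"

lemma coeff_fps_section: "coeff (fps_section f N) k = (if k \<le> N then fps_nth f k else 0)"
  by (simp add: fps_section_def coeff_sum if_distrib[of "\<lambda>x. x = _"] cong: if_cong)

lemma degree_fps_section_le: "degree (fps_section f N) \<le> N"
  by (rule degree_le) (simp add: coeff_fps_section)

lemma ipoly_fps_section: "ipoly (fps_section f N) z = (\<Sum>k\<le>N. of_int (fps_nth f k) * z ^ k)"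
proof -
  have "ipoly (fps_section f N) z = (\<Sum>k\<le>N. of_int (coeff (fps_section f N) k) * z ^ k)"
    unfolding poly_altdef by (rule sum.mono_neutral_cong_left) (auto simp: degree_fps_section_le coeff_eq_0)
  thus ?thesis by (simp add: coeff_fps_section)
qed

text \<open>
  A gap between \<open>N\<close> and \<open>T\<close> makes the section of degree \<open>N\<close> as good an approximation as the one of
  degree \<open>T - 1\<close>.
\<close>

lemma eval_fps_tail:
  assumes A: "\<And>k. \<bar>real_of_int (fps_nth f k)\<bar> \<le> A" and "cmod z < 1"
    and "N < T" and gap: "\<And>k. N < k \<Longrightarrow> k < T \<Longrightarrow> fps_nth f k = 0"
  shows "cmod (eval_fps (complex_fps f) z - ipoly (fps_section f N) z) \<le> A / (1 - cmod z) * cmod z ^ T"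
proof -
  let ?c = "\<lambda>k. of_int (fps_nth f k) * z ^ k"
  have le: "cmod (?c k) \<le> A * cmod z ^ k" for k
    using A[of k] by (auto simp: norm_mult norm_power intro!: mult_right_mono)
  have geo: "summable (\<lambda>k. A * cmod z ^ k)"
    using assms(2) by (intro summable_mult summable_geometric) auto
  have sumc: "summable ?c" by (rule summable_comparison_test'[OF geo]) (use le in auto)
  have "ipoly (fps_section f N) z = (\<Sum>k<T. ?c k)"
    unfolding ipoly_fps_section
    by (rule sum.mono_neutral_cong_left) (use assms(3) gap in auto)
  hence "eval_fps (complex_fps f) z - ipoly (fps_section f N) z = (\<Sum>k. ?c (k + T))"
    unfolding eval_fps_def complex_fps_def fps_nth_Abs_fps
    using suminf_split_initial_segment[OF sumc, of T] by simp
  also have "cmod \<dots> \<le> (\<Sum>k. A * cmod z ^ T * cmod z ^ k)"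
  proof (rule norm_suminf_le)
    show "cmod (?c (k + T)) \<le> A * cmod z ^ T * cmod z ^ k" for k
      using le[of "k + T"] by (simp add: power_add mult_ac)
    show "summable (\<lambda>k. A * cmod z ^ T * cmod z ^ k)"
      using assms(2) by (intro summable_mult summable_geometric) auto
  qed
  also have "\<dots> = A * cmod z ^ T * (1 / (1 - cmod z))"
    using assms(2) by (subst suminf_mult) (auto simp: suminf_geometric intro!: summable_geometric)
  finally show ?thesis by (simp add: algebra_simps)
qed

section \<open>Values of generalized Liouville series\<close>

text \<open>
  The fixed data are those of a generalized Liouville series of bounded type with its two sequences,
  and a pair of conjugate algebraic integers: \<open>\<alpha>\<close>, inside the unit disc, is where the series is
  evaluated, and \<open>\<theta>\<close>, outside of it, is where its sections can be told apart.
\<close>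

locale liouville_value =
  fixes f :: "int fps" and s t :: "nat \<Rightarrow> nat" and A B :: real
    and M :: "int poly" and \<alpha> \<theta> :: complex
  assumes st: "\<And>n. 1 \<le> n \<Longrightarrow> t (n - 1) \<le> s n \<and> s n < t n"
    and gap: "\<And>n k. 1 \<le> n \<Longrightarrow> s n < k \<Longrightarrow> k < t n \<Longrightarrow> fps_nth f k = 0"
    and nonzero: "infinite {k. fps_nth f k \<noteq> 0}"
    and ratio: "filterlim (\<lambda>n. real (t n) / real (s n)) at_top sequentially"
    and quot: "\<And>n. 1 \<le> n \<Longrightarrow> real (s (n + 1)) / real (t n) \<le> B"
    and A1: "1 \<le> A" and A: "\<And>k. \<bar>real_of_int (fps_nth f k)\<bar> \<le> A"
    and M: "irreducible M" "lead_coeff M = 1"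
    and \<alpha>: "ipoly M \<alpha> = 0" "cmod \<alpha> < 1"
    and \<theta>: "ipoly M \<theta> = 0" "2 * A + 2 \<le> cmod \<theta>"
    and dominant: "\<And>z. ipoly M z = 0 \<Longrightarrow> z \<noteq> \<theta> \<Longrightarrow> cmod z < cmod \<theta>"
begin

abbreviation g :: "nat \<Rightarrow> int poly" where "g n \<equiv> fps_section f (s n)"
abbreviation \<gamma> :: complex where "\<gamma> \<equiv> eval_fps (complex_fps f) \<alpha>"
abbreviation \<beta> :: "nat \<Rightarrow> complex" where "\<beta> n \<equiv> ipoly (g n) \<alpha>"
abbreviation m :: nat where "m \<equiv> degree M"

lemma t_ge: "n \<le> t n"
proof (induction n)
  case (Suc n)
  thus ?case using st[of "Suc n"] by auto
qed simp

lemma s_ge: "n \<le> Suc (s n)"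
proof (cases n)
  case (Suc k)
  thus ?thesis using st[of n] t_ge[of k] by auto
qed simp

lemma filterlim_t: "filterlim t at_top sequentially"
  by (rule filterlim_at_top_mono[OF filterlim_ident]) (simp add: t_ge)

lemma B0: "0 \<le> B"
  using quot[of 1] order_trans[OF divide_nonneg_nonneg[of "real (s 2)" "real (t 1)"]]
  by (simp add: numeral_2_eq_2)

lemma s_Suc_le: "1 \<le> n \<Longrightarrow> real (s (n + 1)) \<le> B * real (t n)"
  using quot[of n] st[of n] by (auto simp: divide_le_eq)

text \<open>
  Quantities exponential in \<open>s n\<close> are negligible against those exponential in \<open>t n\<close>: the only use of
  the divergence of \<open>t n / s n\<close>. Choose \<open>L\<close> with \<open>(x / q)^L \<le> 1 / Q\<close>; then \<open>t n \<ge> L s n\<close> eventually.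
\<close>

lemma power_s_le_power_t:
  fixes x q Q :: real
  assumes "0 \<le> x" "x < q" "1 \<le> Q"
  shows "eventually (\<lambda>n. Q ^ s n * x ^ t n \<le> q ^ t n) sequentially"
proof -
  have q: "0 < q" using assms by simp
  have "(\<lambda>L. (x / q) ^ L) \<longlonglongrightarrow> 0" using assms by (intro LIMSEQ_power_zero) auto
  hence "eventually (\<lambda>L. (x / q) ^ L < 1 / Q) sequentially"
    by (rule order_tendstoD(2)) (use assms in auto)
  then obtain L where L: "(x / q) ^ L \<le> 1 / Q"
    unfolding eventually_sequentially using less_imp_le by blast
  have "eventually (\<lambda>n. real L \<le> real (t n) / real (s n)) sequentially"
    using ratio unfolding filterlim_at_top by blast
  thus ?thesis
  proof (rule eventually_mono)
    fix n assume n: "real L \<le> real (t n) / real (s n)"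
    have Lt: "L * s n \<le> t n"
    proof (cases "s n = 0")
      case False
      hence "real L * real (s n) \<le> real (t n)" using n by (simp add: le_divide_eq)
      thus ?thesis by (metis of_nat_le_iff of_nat_mult)
    qed simp
    have "(x / q) ^ t n \<le> (x / q) ^ (L * s n)"
      using Lt assms q by (intro power_decreasing) auto
    also have "\<dots> = ((x / q) ^ L) ^ s n" by (simp add: power_mult)
    also have "\<dots> \<le> (1 / Q) ^ s n" using L assms q by (intro power_mono) auto
    finally have "x ^ t n / q ^ t n \<le> 1 / Q ^ s n" by (simp add: power_divide)
    moreover have "0 < q ^ t n" "0 < Q ^ s n" using q assms(3) by auto
    ultimately show "Q ^ s n * x ^ t n \<le> q ^ t n" by (simp add: field_simps)
  qed
qed

lemma approximation_error: "1 \<le> n \<Longrightarrow> cmod (\<gamma> - \<beta> n) \<le> A / (1 - cmod \<alpha>) * cmod \<alpha> ^ t n"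
  using st gap A \<alpha> by (intro eval_fps_tail) auto

lemma coeff_g: "\<bar>real_of_int (coeff (g n) i)\<bar> \<le> A"
  using A[of i] A1 by (simp add: coeff_fps_section)

lemma filterlim_degree_g: "filterlim (\<lambda>n. degree (g n)) at_top sequentially"
  unfolding filterlim_at_top
proof
  fix D
  obtain k where k: "D \<le> k" "fps_nth f k \<noteq> 0"
    using nonzero unfolding infinite_nat_iff_unbounded_le by blast
  have "D \<le> degree (g n)" if "Suc k \<le> n" for n
  proof -
    have "k \<le> s n" using s_ge[of n] that by simp
    hence "k \<le> degree (g n)" using k(2) by (intro le_degree) (simp add: coeff_fps_section)
    thus ?thesis using k(1) by simp
  qed
  thus "eventually (\<lambda>n. D \<le> degree (g n)) sequentially"
    unfolding eventually_sequentially by blast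
qed

lemma eventually_degree_pos: "eventually (\<lambda>n. 0 < degree (g n)) sequentially"
proof -
  have "eventually (\<lambda>n. 1 \<le> degree (g n)) sequentially"
    using filterlim_degree_g unfolding filterlim_at_top by blast
  thus ?thesis by (rule eventually_mono) simp
qed

lemma g_theta_lower:
  assumes "0 < degree (g n)"
  shows "cmod \<theta> ^ degree (g n) / 2 \<le> cmod (ipoly (g n) \<theta>)"
  using assms by (intro norm_ipoly_ge[OF coeff_g A1 _ \<theta>(2)]) auto

lemma filterlim_g_theta: "filterlim (\<lambda>n. cmod (ipoly (g n) \<theta>)) at_top sequentially"
proof (rule filterlim_at_top_mono)
  have "filterlim (\<lambda>d. cmod \<theta> ^ d) at_top sequentially"
    using \<theta>(2) A1 by (simp add: Archimedean_eventually_pow filterlim_at_top_dense)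
  from filterlim_tendsto_pos_mult_at_top[OF tendsto_const[of "1 / 2"] _ this]
  have "filterlim (\<lambda>d. (1 / 2) * (cmod \<theta> ^ d)) at_top sequentially" by simp
  from filterlim_compose[OF this filterlim_degree_g]
  show "filterlim (\<lambda>n. (1 / 2) * cmod \<theta> ^ degree (g n)) at_top sequentially" .
  show "eventually (\<lambda>n. (1 / 2) * cmod \<theta> ^ degree (g n) \<le> cmod (ipoly (g n) \<theta>)) sequentially"
    using eventually_degree_pos by (rule eventually_mono) (use g_theta_lower in auto)
qed

lemma roots_finite: "finite {z. ipoly M z = 0}"
  using monic_irreducible_roots(1)[OF M] .

text \<open>
  Let \<open>\<rho> \<ge> 2\<close> bound the other conjugates, with \<open>\<rho> < |\<theta>|\<close>, and let \<open>d\<close> be the degree of \<open>g\<^sub>n\<close>. Then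
  \<open>|g\<^sub>n(z)| \<le> 2 A \<rho>^d\<close> for the others, whereas \<open>|g\<^sub>n(\<theta>)| \<ge> |\<theta>|^d / 2\<close>, and \<open>d\<close> tends to infinity.
\<close>

lemma eventually_separated:
  "eventually (\<lambda>n. \<forall>z. ipoly M z = 0 \<longrightarrow> z \<noteq> \<theta> \<longrightarrow> ipoly (g n) z \<noteq> ipoly (g n) \<theta>) sequentially"
proof -
  define \<rho> where "\<rho> = Max (insert 2 (cmod ` ({z. ipoly M z = 0} - {\<theta>})))"
  have fin: "finite (insert 2 (cmod ` ({z. ipoly M z = 0} - {\<theta>})))" using roots_finite by simp
  have \<rho>2: "2 \<le> \<rho>" unfolding \<rho>_def using fin by (intro Max_ge) auto
  have \<rho>z: "cmod z \<le> \<rho>" if "ipoly M z = 0" "z \<noteq> \<theta>" for z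
    unfolding \<rho>_def using fin that by (intro Max_ge) auto
  have \<rho>\<theta>: "\<rho> < cmod \<theta>"
    unfolding \<rho>_def using fin dominant \<theta>(2) A1 by (subst Max_less_iff) auto
  have \<theta>0: "0 < cmod \<theta>" using \<rho>2 \<rho>\<theta> by linarith
  have "norm (\<rho> / cmod \<theta>) < 1" using \<rho>2 \<rho>\<theta> \<theta>0 by (simp add: divide_less_eq)
  hence "(\<lambda>d. (\<rho> / cmod \<theta>) ^ d) \<longlonglongrightarrow> 0" by (rule LIMSEQ_power_zero)
  hence "eventually (\<lambda>d. (\<rho> / cmod \<theta>) ^ d < 1 / (4 * A)) sequentially"
    by (rule order_tendstoD(2)) (use A1 in auto)
  hence "eventually (\<lambda>n. (\<rho> / cmod \<theta>) ^ degree (g n) < 1 / (4 * A)) sequentially"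
    using filterlim_degree_g unfolding filterlim_iff by blast
  thus ?thesis
    using eventually_degree_pos
  proof eventually_elim
    case (elim n)
    let ?d = "degree (g n)"
    show ?case
    proof (intro allI impI notI)
      fix z assume z: "ipoly M z = 0" "z \<noteq> \<theta>" and eq: "ipoly (g n) z = ipoly (g n) \<theta>"
      have "cmod \<theta> ^ ?d / 2 \<le> cmod (ipoly (g n) z)" using g_theta_lower[OF elim(2)] eq by simp
      also have "\<dots> \<le> 2 * A * \<rho> ^ ?d"
        by (rule norm_ipoly_le_geometric[OF coeff_g \<rho>2 \<rho>z[OF z]])
      finally have "cmod \<theta> ^ ?d \<le> 4 * A * \<rho> ^ ?d" by simp
      moreover have "0 < cmod \<theta> ^ ?d" using \<theta>0 by (rule zero_less_power)
      ultimately have "1 / (4 * A) \<le> (\<rho> / cmod \<theta>) ^ ?d" using A1 by (simp add: power_divide field_simps)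
      thus False using elim(1) by simp
    qed
  qed
qed

text \<open>
  Equal values at \<open>\<alpha>\<close> mean equal values at \<open>\<theta>\<close>, where the sections tend to infinity. So the
  approximations \<open>\<beta>\<^sub>n\<close> are infinitely many numbers, and they avoid any finite set in the long run.
\<close>

lemma finite_fibers: "finite {n. \<beta> n = v}"
proof (cases "{n. \<beta> n = v} = {}")
  case False
  then obtain n0 where n0: "\<beta> n0 = v" by blast
  have "ipoly (g n) \<theta> = ipoly (g n0) \<theta>" if "\<beta> n = v" for n
    using root_at_conjugates[OF M(1) \<alpha>(1), of "g n - g n0" \<theta>] \<theta>(1) that n0
    by (simp add: of_int_poly_hom.hom_minus)
  moreover obtain N where "\<And>n. N \<le> n \<Longrightarrow> cmod (ipoly (g n0) \<theta>) < cmod (ipoly (g n) \<theta>)"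
    using filterlim_g_theta unfolding filterlim_at_top_dense eventually_sequentially by blast
  ultimately have "{n. \<beta> n = v} \<subseteq> {..<N}" by (metis (mono_tags, lifting) lessThan_iff linorder_not_le mem_Collect_eq order_less_irrefl subsetI)
  thus ?thesis by (rule finite_subset) simp
qed simp

lemma eventually_not_root:
  assumes "P \<noteq> 0"
  shows "eventually (\<lambda>n. ipoly P (\<beta> n) \<noteq> 0) sequentially"
proof -
  have "finite {v. ipoly P v = 0}" using assms by (intro poly_roots_finite) auto
  hence "finite (\<Union>v\<in>{v. ipoly P v = 0}. {n. \<beta> n = v})" using finite_fibers by blast
  moreover have "{n. \<not> ipoly P (\<beta> n) \<noteq> 0} = (\<Union>v\<in>{v. ipoly P v = 0}. {n. \<beta> n = v})" by auto
  ultimately show ?thesis unfolding cofinite_eq_sequentially[symmetric] eventually_cofinite by simp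
qed

lemma conjugates_g_bound:
  "\<exists>Q\<ge>1. \<forall>n\<ge>2. \<forall>z. ipoly M z = 0 \<longrightarrow> cmod (ipoly (g n) z) \<le> Q ^ s n"
proof -
  define R where "R = cmod \<theta>"
  have R: "cmod z \<le> R" if "ipoly M z = 0" for z
    using dominant[OF that] unfolding R_def by fastforce
  have R1: "1 \<le> R" using \<theta>(2) A1 by (simp add: R_def)
  \<comment> \<open>The restriction to \<open>n \<ge> 2\<close> gives \<open>s n \<ge> 1\<close>, so that constant factors can be absorbed into the base.\<close>
  let ?q = "2 * A * R"
  have AR: "1 \<le> A * R" using mult_mono[OF A1 R1] A1 by simp
  hence q: "1 \<le> ?q" by simp
  have "cmod (ipoly (g n) z) \<le> (?q ^ 2) ^ s n" if n: "2 \<le> n" and z: "ipoly M z = 0" for n z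
  proof -
    have s1: "1 \<le> s n" using s_ge[of n] n by simp
    have "cmod (ipoly (g n) z) \<le> A * (s n + 1) * R ^ s n"
      by (rule norm_ipoly_le[OF coeff_g degree_fps_section_le R1 R[OF z]])
    also have "\<dots> \<le> A * 2 ^ s n * R ^ s n"
    proof -
      have "Suc (s n) \<le> 2 ^ s n" by (simp add: Suc_le_eq less_exp)
      hence "real (Suc (s n)) \<le> real (2 ^ s n)" by (rule of_nat_mono)
      hence "real (s n + 1) \<le> 2 ^ s n" by simp
      thus ?thesis using A1 R1 by (intro mult_right_mono mult_left_mono) auto
    qed
    also have "\<dots> \<le> A ^ s n * 2 ^ s n * R ^ s n"
      using self_le_power[OF A1, of "s n"] s1 R1 by (intro mult_right_mono) auto
    also have "\<dots> = ?q ^ s n" by (simp add: power_mult_distrib)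
    also have "\<dots> \<le> (?q ^ 2) ^ s n" using q by (intro power_mono self_le_power) auto
    finally show ?thesis .
  qed
  thus ?thesis using q by (intro exI[of _ "?q ^ 2"]) (auto simp: one_le_power)
qed

text \<open>
  The value \<open>P(\<beta>\<^sub>n)\<close> is small if both the zero \<open>\<zeta>\<close> and \<open>\<beta>\<^sub>n\<close> are close to \<open>\<gamma>\<close>, but it is the value at
  \<open>\<alpha>\<close> of the integer polynomial \<open>P \<circ> g\<^sub>n\<close>, hence bounded below by means of the norm. The exponent of
  \<open>H\<close> counts one factor for each of the \<open>m\<close> conjugates.
\<close>

lemma liouville_estimate:
  "\<exists>K\<ge>1. \<exists>Q\<ge>1. \<forall>n\<ge>2. \<forall>P H \<zeta>. degree P \<le> k \<longrightarrow> 1 \<le> H \<longrightarrow> (\<forall>i. \<bar>real_of_int (coeff P i)\<bar> \<le> H) \<longrightarrow>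
     ipoly P (\<beta> n) \<noteq> 0 \<longrightarrow> ipoly P \<zeta> = 0 \<longrightarrow> cmod (\<gamma> - \<zeta>) \<le> 1 \<longrightarrow>
     1 \<le> K * H ^ m * Q ^ s n * (cmod (\<gamma> - \<zeta>) + cmod \<alpha> ^ t n)"
proof -
  obtain Q where Q: "1 \<le> Q" "\<And>n z. 2 \<le> n \<Longrightarrow> ipoly M z = 0 \<Longrightarrow> cmod (ipoly (g n) z) \<le> Q ^ s n"
    using conjugates_g_bound by blast
  define A' where "A' = A / (1 - cmod \<alpha>)"
  have A': "0 \<le> A'" using A1 \<alpha>(2) by (simp add: A'_def)
  define R where "R = cmod \<gamma> + 1 + A'"
  have R1: "1 \<le> R" using A' by (simp add: R_def)
  define K where "K = real (k + 1) ^ m * real (k + 1) * R ^ k * (1 + A')"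
  have m1: "1 \<le> m" using degree_pos_of_irreducible_root[OF M(1) \<alpha>(1)] by simp
  have K1: "1 \<le> K"
  proof -
    have "1 \<le> real (k + 1) ^ m * real (k + 1)" by (simp add: mult_ge1_I)
    moreover have "1 \<le> R ^ k" using R1 by simp
    ultimately show ?thesis unfolding K_def using A'
      by (intro mult_ge1_I) auto
  qed
  have main: "1 \<le> K * H ^ m * (Q ^ (k * (m - 1))) ^ s n * (cmod (\<gamma> - \<zeta>) + cmod \<alpha> ^ t n)"
    if n: "2 \<le> n" and P: "degree P \<le> k" "1 \<le> H" "\<And>i. \<bar>real_of_int (coeff P i)\<bar> \<le> H"
      "ipoly P (\<beta> n) \<noteq> 0" "ipoly P \<zeta> = 0" and near: "cmod (\<gamma> - \<zeta>) \<le> 1" for n P H \<zeta>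
  proof -
    define \<delta> where "\<delta> = cmod (\<gamma> - \<zeta>) + cmod \<alpha> ^ t n"
    have \<delta>0: "0 \<le> \<delta>" by (simp add: \<delta>_def)
    have err: "cmod (\<gamma> - \<beta> n) \<le> A' * cmod \<alpha> ^ t n"
      using approximation_error[of n] n unfolding A'_def by simp
    have "A' * cmod \<alpha> ^ t n \<le> A' * 1"
      using A' \<alpha>(2) by (intro mult_left_mono power_le_one) auto
    hence "cmod (\<beta> n) \<le> R" using err norm_triangle_sub[of "\<beta> n" \<gamma>]
      by (simp add: R_def norm_minus_commute)
    have "cmod \<zeta> \<le> R" using near A' norm_triangle_sub[of \<zeta> \<gamma>]
      by (simp add: R_def norm_minus_commute)
    have dist: "cmod (\<beta> n - \<zeta>) \<le> (1 + A') * \<delta>"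
    proof -
      have "cmod (\<beta> n - \<zeta>) \<le> cmod (\<gamma> - \<beta> n) + cmod (\<gamma> - \<zeta>)"
        using norm_triangle_ineq4[of "\<gamma> - \<zeta>" "\<gamma> - \<beta> n"] by simp
      also have "\<dots> \<le> A' * cmod \<alpha> ^ t n + cmod (\<gamma> - \<zeta>)" using err by simp
      also have "\<dots> \<le> (1 + A') * \<delta>" using A' by (simp add: \<delta>_def algebra_simps)
      finally show ?thesis .
    qed
    have "cmod (ipoly P (\<beta> n)) = cmod (ipoly P (\<beta> n) - ipoly P \<zeta>)" using P by simp
    also have "\<dots> \<le> H * (k + 1) * k * R ^ k * cmod (\<beta> n - \<zeta>)"
      by (rule norm_ipoly_diff_le[OF P(3,1) R1]) fact+
    also have "\<dots> \<le> H * (k + 1) * (k + 1) * R ^ k * ((1 + A') * \<delta>)"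
      using P(2) R1 A' dist by (intro mult_mono) auto
    finally have small: "cmod (ipoly P (\<beta> n)) \<le> H * (k + 1) * (k + 1) * R ^ k * ((1 + A') * \<delta>)" .
    define L where "L = H * (k + 1) * (Q ^ s n) ^ k"
    have L0: "0 \<le> L" using P(2) Q(1) by (simp add: L_def)
    have "1 \<le> cmod (ipoly (pcompose P (g n)) \<alpha>) * L ^ (m - 1)"
    proof (rule norm_lower_bound[OF M \<alpha>(1)])
      show "ipoly (pcompose P (g n)) \<alpha> \<noteq> 0" using P(4) by (simp add: ipoly_pcompose)
      fix z assume "ipoly M z = 0"
      thus "cmod (ipoly (pcompose P (g n)) z) \<le> L"
        unfolding ipoly_pcompose L_def using Q n
        by (intro norm_ipoly_le[OF P(3,1)]) auto
    qed
    also have "\<dots> \<le> H * (k + 1) * (k + 1) * R ^ k * ((1 + A') * \<delta>) * L ^ (m - 1)"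
      unfolding ipoly_pcompose by (rule mult_right_mono[OF small]) (use L0 in auto)
    also have "\<dots> = K * H ^ m * (Q ^ (k * (m - 1))) ^ s n * \<delta>"
    proof -
      have *: "L ^ (m - 1) = H ^ (m - 1) * real (k + 1) ^ (m - 1) * (Q ^ (k * (m - 1))) ^ s n"
        unfolding L_def power_mult_distrib power_mult[symmetric] by (simp add: mult_ac)
      have m': "m = Suc (m - 1)" using m1 by simp
      have "H ^ m = H * H ^ (m - 1)" by (subst m') (rule power_Suc)
      moreover have "real (k + 1) ^ m = real (k + 1) * real (k + 1) ^ (m - 1)"
        by (subst m') (rule power_Suc)
      ultimately show ?thesis unfolding * K_def by (simp only: mult_ac)
    qed
    finally show ?thesis unfolding \<delta>_def .
  qed
  have Q': "1 \<le> Q ^ (k * (m - 1))" using Q(1) by simp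
  show ?thesis
    by (rule exI[of _ K], intro conjI K1, rule exI[of _ "Q ^ (k * (m - 1))"], intro conjI Q' allI impI, rule main) blast+
qed

lemma power_t_small:
  fixes q e :: real
  assumes "0 \<le> q" "q < 1" "0 < e"
  shows "eventually (\<lambda>n. q ^ t n < e) sequentially"
proof -
  have "(\<lambda>n. q ^ n) \<longlonglongrightarrow> 0" using assms by (intro LIMSEQ_power_zero) auto
  hence "(\<lambda>n. q ^ t n) \<longlonglongrightarrow> 0" by (rule filterlim_compose[OF _ filterlim_t])
  thus ?thesis using assms(3) by (rule order_tendstoD(2))
qed

text \<open>
  Any number strictly between \<open>|\<alpha>|\<close> and \<open>1\<close> would do.
\<close>

definition q :: real where "q = (1 + cmod \<alpha>) / 2"

lemma q: "0 < q" "q < 1" "cmod \<alpha> < q"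
proof -
  have "0 \<le> cmod \<alpha>" by simp
  thus "0 < q" "q < 1" "cmod \<alpha> < q" using \<alpha>(2) by (simp_all add: q_def add_pos_nonneg)
qed

lemma transcendental: "\<not> algebraic \<gamma>"
proof
  assume "algebraic \<gamma>"
  then obtain P where P: "P \<noteq> 0" "ipoly P \<gamma> = 0" unfolding algebraic_iff_ipoly by blast
  define H where "H = real_of_int (max_abs_coeff P)"
  have H: "1 \<le> H" "\<And>i. \<bar>real_of_int (coeff P i)\<bar> \<le> H"
    using max_abs_coeff_ge_1[OF P(1)] abs_coeff_le_max[of P] unfolding H_def of_int_abs[symmetric] of_int_le_iff
    by simp_all
  obtain K Q where K: "1 \<le> K" "1 \<le> Q"
    "\<forall>n\<ge>2. \<forall>P' H \<zeta>. degree P' \<le> degree P \<longrightarrow> 1 \<le> H \<longrightarrow> (\<forall>i. \<bar>real_of_int (coeff P' i)\<bar> \<le> H) \<longrightarrow>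
     ipoly P' (\<beta> n) \<noteq> 0 \<longrightarrow> ipoly P' \<zeta> = 0 \<longrightarrow> cmod (\<gamma> - \<zeta>) \<le> 1 \<longrightarrow>
     1 \<le> K * H ^ m * Q ^ s n * (cmod (\<gamma> - \<zeta>) + cmod \<alpha> ^ t n)"
    using liouville_estimate[of "degree P"] by blast
  define c where "c = K * H ^ m"
  have c: "0 < c" unfolding c_def using K(1) H(1) by (intro mult_pos_pos zero_less_power) auto
  have "eventually (\<lambda>n. Q ^ s n * cmod \<alpha> ^ t n \<le> q ^ t n) sequentially"
    by (rule power_s_le_power_t) (use q K in auto)
  moreover have "eventually (\<lambda>n. q ^ t n < 1 / c) sequentially"
    by (rule power_t_small) (use q c in auto)
  ultimately have "eventually (\<lambda>n. False) sequentially"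
    using eventually_not_root[OF P(1)] eventually_ge_at_top[of 2]
  proof eventually_elim
    case (elim n)
    have "1 \<le> c * Q ^ s n * (cmod (\<gamma> - \<gamma>) + cmod \<alpha> ^ t n)"
      unfolding c_def by (rule K(3)[rule_format, OF elim(4) _ H(1) _ elim(3) P(2)]) (use H(2) in auto)
    also have "\<dots> = c * (Q ^ s n * cmod \<alpha> ^ t n)" by simp
    also have "\<dots> \<le> c * q ^ t n" using elim(1) c by (intro mult_left_mono) auto
    also have "\<dots> < c * (1 / c)" using elim(2) c by (rule mult_strict_left_mono)
    also have "\<dots> = 1" using c by simp
    finally show False by simp
  qed
  thus False by simp
qed

lemma min_poly_beta:
  "eventually (\<lambda>n. \<exists>\<Phi>. irreducible \<Phi> \<and> lead_coeff \<Phi> = 1 \<and> degree \<Phi> = m \<and> ipoly \<Phi> (\<beta> n) = 0 \<and>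
     of_int_poly \<Phi> = (\<Prod>z | ipoly M z = 0. [:- ipoly (g n) z, 1:])) sequentially"
  using eventually_separated
  by (rule eventually_mono) (intro min_poly_of_conjugate_separating[OF M \<alpha>(1) \<theta>(1)], blast)

text \<open>
  The infinitely many numbers \<open>\<beta>\<^sub>n\<close> are the approximations: their heights are at most \<open>D^(s n)\<close>, and
  \<open>D^(w s n) |\<alpha>|^(t n)\<close> tends to \<open>0\<close> for each \<open>w\<close>.
\<close>

lemma well_approximable_m: "well_approximable m \<gamma>"
  unfolding well_approximable_def
proof (intro allI impI)
  fix w :: real assume w: "0 < w"
  obtain Q where Q: "1 \<le> Q" "\<And>n z. 2 \<le> n \<Longrightarrow> ipoly M z = 0 \<Longrightarrow> cmod (ipoly (g n) z) \<le> Q ^ s n"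
    using conjugates_g_bound by blast
  define D where "D = (2 * Q) ^ m"
  have D1: "1 \<le> D" using Q(1) unfolding D_def by (intro one_le_power) simp
  define A' where "A' = A / (1 - cmod \<alpha>)"
  have A': "0 < A'" using A1 \<alpha>(2) by (simp add: A'_def)
  let ?S = "{\<beta>. algebraic \<beta> \<and> algebraic_degree \<beta> = m \<and>
          cmod (\<gamma> - \<beta>) < real_of_int (max_abs_coeff (int_min_poly \<beta>)) powr (- w)}"
  have "eventually (\<lambda>n. (D powr w) ^ s n * cmod \<alpha> ^ t n \<le> q ^ t n) sequentially"
    by (rule power_s_le_power_t) (use q D1 w in \<open>auto simp: ge_one_powr_ge_zero\<close>)
  moreover have "eventually (\<lambda>n. q ^ t n < 1 / A') sequentially"
    by (rule power_t_small) (use q A' in auto)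
  ultimately have "eventually (\<lambda>n. \<beta> n \<in> ?S) sequentially"
    using min_poly_beta eventually_ge_at_top[of 2]
  proof eventually_elim
    case (elim n)
    then obtain \<Phi> where \<Phi>: "irreducible \<Phi>" "degree \<Phi> = m" "ipoly \<Phi> (\<beta> n) = 0"
      "of_int_poly \<Phi> = (\<Prod>z | ipoly M z = 0. [:- ipoly (g n) z, 1:])" by blast
    have "algebraic (\<beta> n)" using \<Phi>(1,3) algebraic_iff_ipoly by (metis not_irreducible_zero)
    moreover have "algebraic_degree (\<beta> n) = m" using algebraic_degree_eq \<Phi> by simp
    moreover have "cmod (\<gamma> - \<beta> n) < real_of_int (max_abs_coeff (int_min_poly (\<beta> n))) powr (- w)"
    proof -
      define H where "H = real_of_int (max_abs_coeff (int_min_poly (\<beta> n)))"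
      have "max_abs_coeff (int_min_poly (\<beta> n)) = max_abs_coeff \<Phi>"
        using int_min_poly_eq[OF \<Phi>(1,3)] by auto
      hence H: "H = real_of_int (max_abs_coeff \<Phi>)" by (simp add: H_def)
      have "\<Phi> \<noteq> 0" using \<Phi>(1) by auto
      hence "max_abs_coeff \<Phi> \<ge> 1" by (rule max_abs_coeff_ge_1)
      hence H1: "1 \<le> H" using H by simp
      have s1: "1 \<le> s n" using s_ge[of n] elim(4) by simp
      have "max_abs_coeff \<Phi> \<le> \<lfloor>D ^ s n\<rfloor>"
      proof (rule max_abs_coeff_le)
        fix i
        have "real_of_int \<bar>coeff \<Phi> i\<bar> = cmod (coeff (of_int_poly \<Phi>) i)" by simp
        also have "\<dots> \<le> (\<Prod>z | ipoly M z = 0. 1 + cmod (ipoly (g n) z))"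
          unfolding \<Phi>(4) by (rule norm_coeff_prod_linear_le[OF roots_finite])
        also have "\<dots> \<le> (\<Prod>z | ipoly M z = 0. (2 * Q) ^ s n)"
        proof (rule prod_mono, safe)
          fix z assume "ipoly M z = 0"
          have "1 + cmod (ipoly (g n) z) \<le> 1 * Q ^ s n + Q ^ s n"
            using Q(2)[OF elim(4) \<open>ipoly M z = 0\<close>] one_le_power[OF Q(1), of "s n"] by simp
          also have "\<dots> \<le> 2 ^ s n * Q ^ s n"
            using self_le_power[of "2 :: real" "s n"] s1 Q(1) by (simp add: mult_right_mono)
          finally show "1 + cmod (ipoly (g n) z) \<le> (2 * Q) ^ s n" by (simp add: power_mult_distrib)
        qed auto
        also have "\<dots> = D ^ s n"
          unfolding prod_constant monic_irreducible_roots(2)[OF M] D_def power_mult[symmetric]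
          by (simp only: mult.commute)
        finally show "\<bar>coeff \<Phi> i\<bar> \<le> \<lfloor>D ^ s n\<rfloor>" by (simp add: le_floor_iff)
      qed
      hence HD: "H \<le> D ^ s n" unfolding H by (simp add: le_floor_iff)
      have "cmod (\<gamma> - \<beta> n) \<le> A' * cmod \<alpha> ^ t n"
        using approximation_error[of n] elim(4) by (simp add: A'_def)
      hence "cmod (\<gamma> - \<beta> n) * H powr w \<le> (A' * cmod \<alpha> ^ t n) * (D ^ s n) powr w"
        using HD H1 w A' by (intro mult_mono powr_mono2) auto
      also have "(D ^ s n) powr w = (D powr w) ^ s n"
        using D1 by (simp add: powr_power powr_realpow[symmetric] powr_powr mult.commute)
      also have "(A' * cmod \<alpha> ^ t n) * (D powr w) ^ s n \<le> A' * q ^ t n"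
        using elim(1) A' by (simp add: mult_ac)
      also have "\<dots> < A' * (1 / A')" using elim(2) A' by (intro mult_strict_left_mono)
      also have "\<dots> = 1" using A' by simp
      finally show ?thesis using H1 unfolding H_def[symmetric] by (simp add: powr_minus field_simps)
    qed
    ultimately show ?case by blast
  qed
  then obtain N where N: "\<And>n. N \<le> n \<Longrightarrow> \<beta> n \<in> ?S" unfolding eventually_sequentially by blast
  show "infinite ?S"
  proof
    assume "finite ?S"
    hence "finite (\<Union>v\<in>?S. {n. \<beta> n = v})" using finite_fibers by blast
    moreover have "{N..} \<subseteq> (\<Union>v\<in>?S. {n. \<beta> n = v})" using N by blast
    ultimately have "finite {N..}" using finite_subset by blast
    thus False by (simp add: infinite_Ici)
  qed
qed

text \<open>
  As \<open>\<beta>\<^sub>n\<close> has degree \<open>m > k\<close> for \<open>n \<ge> N\<close>, it is not a zero of an irreducible polynomial of degree \<open>k\<close>, and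
  the Liouville estimate applies to all approximations of degree \<open>k\<close> with a common threshold \<open>N\<close>.
\<close>

lemma not_well_approximable:
  assumes k: "0 < k" "k < m"
  shows "\<not> well_approximable k \<gamma>"
proof
  assume wa: "well_approximable k \<gamma>"
  obtain K Q where K: "1 \<le> K" "1 \<le> Q"
    "\<forall>n\<ge>2. \<forall>P' H \<zeta>. degree P' \<le> k \<longrightarrow> 1 \<le> H \<longrightarrow> (\<forall>i. \<bar>real_of_int (coeff P' i)\<bar> \<le> H) \<longrightarrow>
     ipoly P' (\<beta> n) \<noteq> 0 \<longrightarrow> ipoly P' \<zeta> = 0 \<longrightarrow> cmod (\<gamma> - \<zeta>) \<le> 1 \<longrightarrow>
     1 \<le> K * H ^ m * Q ^ s n * (cmod (\<gamma> - \<zeta>) + cmod \<alpha> ^ t n)"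
    using liouville_estimate[of "k"] by blast
  have "eventually (\<lambda>n. algebraic_degree (\<beta> n) = m) sequentially"
    using min_poly_beta by (rule eventually_mono) (use algebraic_degree_eq in auto)
  moreover have "eventually (\<lambda>n. Q ^ s n * cmod \<alpha> ^ t n \<le> q ^ t n) sequentially"
    by (rule power_s_le_power_t) (use q K in auto)
  ultimately have "eventually (\<lambda>n. 2 \<le> n \<and> algebraic_degree (\<beta> n) = m \<and>
      Q ^ s n * cmod \<alpha> ^ t n \<le> q ^ t n) sequentially"
    using eventually_ge_at_top[of 2] by eventually_elim simp
  then obtain N where N: "\<And>n. N \<le> n \<Longrightarrow> 2 \<le> n" "\<And>n. N \<le> n \<Longrightarrow> algebraic_degree (\<beta> n) = m"
      "\<And>n. N \<le> n \<Longrightarrow> Q ^ s n * cmod \<alpha> ^ t n \<le> q ^ t n"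
    unfolding eventually_sequentially by blast
  define c where "c = - ln q"
  have c: "0 < c" using q by (simp add: c_def)
  define e where "e = ln Q * B / c"
  have e: "0 \<le> e" unfolding e_def using K(2) B0 c by simp
  have lower: "1 \<le> (2 * K * H ^ m) powr (1 + e) * Q ^ s N * cmod (\<gamma> - \<zeta>)"
    if P: "irreducible P" "degree P = k" "1 \<le> H" "\<And>i. \<bar>real_of_int (coeff P i)\<bar> \<le> H"
      "ipoly P \<zeta> = 0" "cmod (\<gamma> - \<zeta>) \<le> 1" for P H \<zeta>
  proof -
    define Y where "Y = 2 * K * H ^ m"
    have "1 \<le> K * H ^ m" using K(1) P(3) by (intro mult_ge1_I one_le_power)
    hence Y: "1 \<le> Y" "0 < Y" by (simp_all add: Y_def)
    \<comment> \<open>For this n the term with \<open>|\<alpha>|^(t n)\<close> takes up at most half of the estimate; minimality keeps \<open>s n\<close> small.\<close>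
    define n where "n = (LEAST n. N \<le> n \<and> ln Y \<le> t n * c)"
    have "\<exists>n. N \<le> n \<and> ln Y \<le> t n * c"
    proof (intro exI[of _ "max N (nat \<lceil>ln Y / c\<rceil>)"] conjI)
      let ?n = "max N (nat \<lceil>ln Y / c\<rceil>)"
      have "ln Y / c \<le> real (nat \<lceil>ln Y / c\<rceil>)" by linarith
      also have "\<dots> \<le> real ?n" by simp
      also have "\<dots> \<le> real (t ?n)" using t_ge by simp
      finally show "ln Y \<le> t ?n * c" using c by (simp add: divide_le_eq)
    qed simp
    from LeastI_ex[OF this] have n: "N \<le> n" "ln Y \<le> t n * c" unfolding n_def by blast+
    have sn: "real (s n) \<le> real (s N) + B * (ln Y / c)"
    proof (cases "n = N")
      case True
      thus ?thesis using B0 Y c by simp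
    next
      case False
      hence lt: "n - 1 < n" "N \<le> n - 1" "1 \<le> n - 1" "n = (n - 1) + 1" using n(1) N(1)[of N] by auto
      have "\<not> (N \<le> n - 1 \<and> ln Y \<le> t (n - 1) * c)"
        using not_less_Least lt(1) unfolding n_def by blast
      hence "t (n - 1) \<le> ln Y / c" using lt(2) c by (simp add: le_divide_eq)
      hence "B * t (n - 1) \<le> B * (ln Y / c)" using B0 by (rule mult_left_mono)
      moreover have "real (s n) \<le> B * t (n - 1)" using s_Suc_le[OF lt(3)] lt(4) by simp
      ultimately show ?thesis by simp
    qed
    have Qs: "Q ^ s n \<le> Q ^ s N * Y powr e"
    proof -
      have "Q ^ s n = Q powr real (s n)" using K(2) by (simp add: powr_realpow)
      also have "\<dots> \<le> Q powr (real (s N) + B * (ln Y / c))" using sn K(2) by (rule powr_mono)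
      also have "\<dots> = Q ^ s N * Q powr (B * (ln Y / c))" using K(2) by (simp add: powr_add powr_realpow)
      also have "Q powr (B * (ln Y / c)) = Y powr e"
        using K(2) Y by (simp add: powr_def e_def mult_ac)
      finally show ?thesis .
    qed
    have qt: "q ^ t n \<le> 1 / Y"
    proof -
      have "q ^ t n = exp (- (t n * c))"
        using q(1) by (simp add: c_def exp_of_nat_mult)
      also have "\<dots> \<le> exp (- ln Y)" using n(2) by simp
      also have "\<dots> = 1 / Y" using Y by (simp add: exp_minus divide_inverse)
      finally show ?thesis .
    qed
    have "ipoly P (\<beta> n) \<noteq> 0"
      using algebraic_degree_eq[OF P(1)] N(2)[OF n(1)] P(2) k(2) by auto
    hence "1 \<le> K * H ^ m * Q ^ s n * (cmod (\<gamma> - \<zeta>) + cmod \<alpha> ^ t n)"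
      by (intro K(3)[rule_format, OF N(1)[OF n(1)] _ P(3,4) _ P(5,6)]) (simp add: P(2))
    also have "\<dots> = (Y * Q ^ s n * cmod (\<gamma> - \<zeta>) + Y * (Q ^ s n * cmod \<alpha> ^ t n)) / 2"
      by (simp add: Y_def algebra_simps)
    finally have "2 \<le> Y * Q ^ s n * cmod (\<gamma> - \<zeta>) + Y * (Q ^ s n * cmod \<alpha> ^ t n)" by simp
    also have "Y * (Q ^ s n * cmod \<alpha> ^ t n) \<le> Y * (1 / Y)"
      using N(3)[OF n(1)] qt Y by (intro mult_left_mono) auto
    also have "Y * (1 / Y) = 1" using Y by simp
    finally have "1 \<le> Y * Q ^ s n * cmod (\<gamma> - \<zeta>)" by simp
    also have "\<dots> \<le> Y * (Q ^ s N * Y powr e) * cmod (\<gamma> - \<zeta>)"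
      using Qs Y by (intro mult_right_mono mult_left_mono) auto
    also have "\<dots> = Y powr (1 + e) * Q ^ s N * cmod (\<gamma> - \<zeta>)"
      using Y by (simp add: powr_add)
    finally show ?thesis by (simp add: Y_def)
  qed
  \<comment> \<open>One more than the exponent of H in the lower bound, so that only bounded heights survive.\<close>
  define w where "w = real m * (1 + e) + 1"
  have w: "0 < w" using e by (simp add: w_def add_nonneg_pos)
  define H0 where "H0 = (2 * K) powr (1 + e) * Q ^ s N"
  let ?S = "{\<beta>. algebraic \<beta> \<and> algebraic_degree \<beta> = k \<and>
          cmod (\<gamma> - \<beta>) < real_of_int (max_abs_coeff (int_min_poly \<beta>)) powr (- w)}"
  have "?S \<subseteq> {\<beta>. algebraic \<beta> \<and> algebraic_degree \<beta> = k \<and> max_abs_coeff (int_min_poly \<beta>) \<le> \<lceil>H0\<rceil>}"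
  proof safe
    fix \<zeta> assume \<zeta>: "algebraic \<zeta>" "k = algebraic_degree \<zeta>"
      "cmod (\<gamma> - \<zeta>) < real_of_int (max_abs_coeff (int_min_poly \<zeta>)) powr (- w)"
    define P where "P = int_min_poly \<zeta>"
    define H where "H = real_of_int (max_abs_coeff P)"
    note P = int_min_poly[OF \<zeta>(1), folded P_def]
    have "P \<noteq> 0" using P(1) by auto
    hence H1: "1 \<le> H" using max_abs_coeff_ge_1 unfolding H_def by simp
    have near: "cmod (\<gamma> - \<zeta>) < H powr (- w)" using \<zeta>(3) by (simp add: H_def P_def)
    also have "\<dots> \<le> 1" using H1 w by (simp add: powr_minus divide_simps ge_one_powr_ge_zero)
    finally have near1: "cmod (\<gamma> - \<zeta>) \<le> 1" by simp
    have "1 \<le> (2 * K * H ^ m) powr (1 + e) * Q ^ s N * cmod (\<gamma> - \<zeta>)"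
    proof (rule lower[OF P(1) _ H1 _ P(2) near1])
      show "degree P = k" using \<zeta>(1,2) algebraic_degree_int_min_poly by (simp add: P_def)
      show "\<bar>real_of_int (coeff P i)\<bar> \<le> H" for i
        unfolding H_def of_int_abs[symmetric] of_int_le_iff by (rule abs_coeff_le_max)
    qed
    also have "(2 * K * H ^ m) powr (1 + e) = (2 * K) powr (1 + e) * H powr (real m * (1 + e))"
      using K(1) H1 by (simp add: powr_mult powr_powr flip: powr_realpow)
    also have "(2 * K) powr (1 + e) * H powr (real m * (1 + e)) * Q ^ s N * cmod (\<gamma> - \<zeta>)
        \<le> H0 * H powr (real m * (1 + e)) * H powr (- w)"
    proof -
      have "H0 * H powr (real m * (1 + e)) * cmod (\<gamma> - \<zeta>) \<le> H0 * H powr (real m * (1 + e)) * H powr (- w)"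
        using near K(2) unfolding H0_def by (intro mult_left_mono) auto
      thus ?thesis unfolding H0_def by (simp only: mult_ac)
    qed
    also have "\<dots> = H0 / H"
      using H1 by (simp add: w_def mult.assoc powr_add[symmetric] powr_minus_divide)
    finally have "H \<le> H0" using H1 by (simp add: le_divide_eq)
    thus "max_abs_coeff (int_min_poly \<zeta>) \<le> \<lceil>H0\<rceil>"
      unfolding H_def P_def by linarith
  qed
  from finite_subset[OF this finite_algebraic_bounded]
  show False using wa w unfolding well_approximable_def by blast
qed

lemma value_in_U: "\<gamma> \<in> U_numbers m"
  unfolding U_numbers_def
  using transcendental well_approximable_m not_well_approximable
    degree_pos_of_irreducible_root[OF M(1) \<alpha>(1)] by simp

end

section \<open>Counting integer polynomials\<close>

text \<open>
  The Mahler measure is monotone under divisibility, is bounded by the Euclidean norm of the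
  coefficients (inequality of Landau), and bounds each coefficient up to a binomial factor.
\<close>

lemma factor_coeff_bound:
  fixes F G :: "int poly" and N :: nat
  assumes F: "F \<noteq> 0" "degree F \<le> m" "\<And>i. \<bar>coeff F i\<bar> \<le> int N" and dvd: "G dvd F"
  shows "\<bar>coeff G k\<bar> \<le> int (2 ^ m * (m + 1) * N)"
proof -
  let ?F = "of_int_poly F :: complex poly"
  have "mahler_measure F \<le> l2norm_complex ?F"
    using Landau_inequality[of ?F] unfolding mahler_measure_def .
  also have "\<dots> \<le> sqrt ((real (m + 1) * real N)\<^sup>2)"
  proof (rule real_sqrt_le_mono)
    have "(\<Sum>a\<leftarrow>coeffs ?F. (cmod a)\<^sup>2) \<le> (\<Sum>a\<leftarrow>coeffs ?F. (real N)\<^sup>2)"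
    proof (rule sum_list_mono)
      fix a assume "a \<in> set (coeffs ?F)"
      then obtain i where "a = of_int (coeff F i)"
        by (auto simp: in_set_conv_nth nth_coeffs_coeff length_coeffs_degree split: if_splits)
      hence "cmod a = real_of_int \<bar>coeff F i\<bar>" by simp
      also have "\<dots> \<le> real N" using F(3)[of i] by linarith
      finally show "(cmod a)\<^sup>2 \<le> (real N)\<^sup>2" by (simp add: power_mono)
    qed
    also have "\<dots> = real (length (coeffs ?F)) * (real N)\<^sup>2" by (simp add: sum_list_triv)
    also have "\<dots> \<le> real (m + 1) * (real N)\<^sup>2"
      using F(1,2) by (intro mult_right_mono) (auto simp: length_coeffs_degree)
    also have "\<dots> \<le> (real (m + 1))\<^sup>2 * (real N)\<^sup>2"
      by (intro mult_right_mono self_le_power) auto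
    finally show "(\<Sum>a\<leftarrow>coeffs ?F. (cmod a)\<^sup>2) \<le> (real (m + 1) * real N)\<^sup>2"
      by (simp add: power_mult_distrib)
  qed
  also have "\<dots> = real (m + 1) * real N" by simp
  finally have mF: "mahler_measure F \<le> real (m + 1) * real N" .
  have "degree G \<le> m" using dvd_imp_degree_le[OF dvd F(1)] F(2) by simp
  hence "2 ^ degree G \<le> (2 :: nat) ^ m" by simp
  hence ch: "degree G choose k \<le> 2 ^ m" using binomial_le_pow2 order_trans by blast
  have "real_of_int \<bar>coeff G k\<bar> \<le> real (degree G choose k) * mahler_measure G"
    using Mignotte_bound .
  also have "\<dots> \<le> real (2 ^ m) * (real (m + 1) * real N)"
  proof (intro mult_mono of_nat_mono ch)
    show "mahler_measure G \<le> real (m + 1) * real N"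
      using mahler_measure_dvd[OF F(1) dvd] mF by linarith
  qed (auto intro: mahler_measure_ge_0)
  also have "\<dots> = real_of_int (int (2 ^ m * (m + 1) * N))" by (simp add: algebra_simps)
  finally show ?thesis unfolding of_int_le_iff .
qed

definition coeff_box :: "nat \<Rightarrow> (nat \<Rightarrow> int set) \<Rightarrow> int poly set" where
  "coeff_box m S = {P. degree P \<le> m \<and> (\<forall>i\<le>m. coeff P i \<in> S i)}"

lemma
  assumes "\<And>i. i \<le> m \<Longrightarrow> finite (S i)"
  shows finite_coeff_box: "finite (coeff_box m S)"
    and card_coeff_box: "card (coeff_box m S) = (\<Prod>i\<le>m. card (S i))"
proof -
  let ?r = "\<lambda>P. restrict (coeff P) {..m}"
  have "bij_betw ?r (coeff_box m S) (PiE {..m} S)"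
  proof (rule bij_betw_imageI)
    show "inj_on ?r (coeff_box m S)"
    proof (rule inj_onI)
      fix P Q assume PQ: "P \<in> coeff_box m S" "Q \<in> coeff_box m S" "?r P = ?r Q"
      show "P = Q"
      proof (rule poly_eqI)
        fix i
        show "coeff P i = coeff Q i"
        proof (cases "i \<le> m")
          case True
          thus ?thesis using fun_cong[OF PQ(3), of i] by simp
        next
          case False
          thus ?thesis using PQ(1,2) by (simp add: coeff_box_def coeff_eq_0)
        qed
      qed
    qed
    show "?r ` coeff_box m S = PiE {..m} S"
    proof
      show "?r ` coeff_box m S \<subseteq> PiE {..m} S"
        by (rule image_subsetI) (simp add: coeff_box_def restrict_PiE_iff)
      show "PiE {..m} S \<subseteq> ?r ` coeff_box m S"
      proof
        fix c assume c: "c \<in> PiE {..m} S"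
        define P where "P = (\<Sum>i\<le>m. monom (c i) i)"
        have cP: "coeff P i = (if i \<le> m then c i else 0)" for i
          by (simp add: P_def coeff_sum if_distrib[of "\<lambda>x. x = _"] cong: if_cong)
        have "?r P = c"
        proof
          show "?r P i = c i" for i using c by (cases "i \<le> m") (auto simp: cP PiE_def extensional_def)
        qed
        moreover have "P \<in> coeff_box m S"
          using c by (auto simp: coeff_box_def cP intro!: degree_le)
        ultimately show "c \<in> ?r ` coeff_box m S" by blast
      qed
    qed
  qed
  note bij = this
  have "finite (PiE {..m} S)" using assms by (intro finite_PiE) auto
  thus "finite (coeff_box m S)" using bij_betw_finite[OF bij] by blast
  show "card (coeff_box m S) = (\<Prod>i\<le>m. card (S i))"
    using bij_betw_same_card[OF bij] card_PiE[of "{..m}" S] by simp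
qed

definition sym_range :: "nat \<Rightarrow> int set" where "sym_range N = {- int N..int N}"

lemma sym_range [simp]: "finite (sym_range N)" "card (sym_range N) = 2 * N + 1"
  by (simp_all add: sym_range_def)

lemma in_sym_range: "x \<in> sym_range N \<longleftrightarrow> \<bar>x\<bar> \<le> int N"
  by (auto simp: sym_range_def)

definition monic_unit_polys :: "nat \<Rightarrow> nat \<Rightarrow> int poly set" where
  "monic_unit_polys m N = coeff_box m (\<lambda>i. if i = m then {1} else if i = 0 then {1, -1} else sym_range N)"

definition unit_polys :: "nat \<Rightarrow> nat \<Rightarrow> int poly set" where
  "unit_polys m N = coeff_box m (\<lambda>i. if i = m \<or> i = 0 then {1, -1} else sym_range N)"

lemma finite_monic_unit_polys: "finite (monic_unit_polys m N)"
  unfolding monic_unit_polys_def by (rule finite_coeff_box) auto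

lemma finite_unit_polys: "finite (unit_polys m N)"
  unfolding unit_polys_def by (rule finite_coeff_box) auto

lemma card_monic_unit_polys: "card (monic_unit_polys (Suc k) N) = 2 * (2 * N + 1) ^ k"
proof -
  have "card (monic_unit_polys (Suc k) N) =
      (\<Prod>i\<le>Suc k. card (if i = Suc k then {1 :: int} else if i = 0 then {1, -1} else sym_range N))"
    unfolding monic_unit_polys_def by (rule card_coeff_box) auto
  also have "\<dots> = (\<Prod>i\<le>k. card (if i = 0 then {1 :: int, -1} else sym_range N))"
    by simp
  also have "\<dots> = 2 * (2 * N + 1) ^ k"
    by (cases k) (simp_all add: prod.atMost_Suc_shift del: prod.atMost_Suc)
  finally show ?thesis .
qed

lemma card_unit_polys: "card (unit_polys (Suc k) N) = 4 * (2 * N + 1) ^ k"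
proof -
  have "card (unit_polys (Suc k) N) =
      (\<Prod>i\<le>Suc k. card (if i = Suc k \<or> i = 0 then {1 :: int, -1} else sym_range N))"
    unfolding unit_polys_def by (rule card_coeff_box) auto
  also have "\<dots> = 2 * (\<Prod>i\<le>k. card (if i = 0 then {1 :: int, -1} else sym_range N))"
    by (simp add: mult.commute)
  also have "(\<Prod>i\<le>k. card (if i = 0 then {1 :: int, -1} else sym_range N)) = 2 * (2 * N + 1) ^ k"
    by (cases k) (simp_all add: prod.atMost_Suc_shift del: prod.atMost_Suc)
  finally show ?thesis by simp
qed

lemma card_small_trace:
  "card {P \<in> monic_unit_polys (k + 2) N. \<bar>coeff P (k + 1)\<bar> \<le> int T} \<le> 2 * (2 * T + 1) * (2 * N + 1) ^ k"
proof -
  let ?S = "\<lambda>i. if i = k + 2 then {1 :: int} else if i = k + 1 then sym_range T else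
      if i = 0 then {1, -1} else sym_range N"
  have "{P \<in> monic_unit_polys (k + 2) N. \<bar>coeff P (k + 1)\<bar> \<le> int T} \<subseteq> coeff_box (k + 2) ?S"
    by (auto simp: monic_unit_polys_def coeff_box_def in_sym_range)
  hence "card {P \<in> monic_unit_polys (k + 2) N. \<bar>coeff P (k + 1)\<bar> \<le> int T} \<le> card (coeff_box (k + 2) ?S)"
    by (intro card_mono finite_coeff_box) auto
  also have "\<dots> = (\<Prod>i\<le>Suc (Suc k). card (?S i))" by (subst card_coeff_box) auto
  also have "\<dots> = (2 * T + 1) * (\<Prod>i\<le>k. card (if i = 0 then {1 :: int, -1} else sym_range N))"
    by (simp add: mult.commute)
  also have "(\<Prod>i\<le>k. card (if i = 0 then {1 :: int, -1} else sym_range N)) = 2 * (2 * N + 1) ^ k"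
    by (cases k) (simp_all add: prod.atMost_Suc_shift del: prod.atMost_Suc)
  finally show ?thesis by (simp add: mult_ac)
qed

lemma monic_unit_polysD:
  assumes "P \<in> monic_unit_polys m N" "0 < m"
  shows "degree P = m" "lead_coeff P = 1" "\<bar>coeff P 0\<bar> = 1"
    and "1 \<le> N \<Longrightarrow> \<bar>coeff P i\<bar> \<le> int N"
proof -
  have P: "degree P \<le> m" "\<And>i. i \<le> m \<Longrightarrow> coeff P i \<in> (if i = m then {1} else if i = 0 then {1, -1} else sym_range N)"
    using assms(1) by (auto simp: monic_unit_polys_def coeff_box_def)
  have "coeff P m = 1" using P(2)[of m] by simp
  thus *: "degree P = m" using P(1) by (metis le_antisym le_degree zero_neq_one)
  show "lead_coeff P = 1" using \<open>coeff P m = 1\<close> * by simp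
  show "\<bar>coeff P 0\<bar> = 1" using P(2)[of 0] assms(2) by (auto split: if_splits)
  show "\<bar>coeff P i\<bar> \<le> int N" if "1 \<le> N"
  proof (cases "i \<le> m")
    case True
    thus ?thesis using P(2)[of i] that by (auto simp: in_sym_range split: if_splits)
  next
    case False
    thus ?thesis using P(1) by (simp add: coeff_eq_0)
  qed
qed

lemma in_unit_polys:
  assumes "degree Q = e" "\<bar>lead_coeff Q\<bar> = 1" "\<bar>coeff Q 0\<bar> = 1" "\<And>i. \<bar>coeff Q i\<bar> \<le> int H"
  shows "Q \<in> unit_polys e H"
  using assms by (auto simp: unit_polys_def coeff_box_def in_sym_range)

text \<open>
  The leading coefficients of the two factors have product \<open>1\<close>, and their constant coefficients have
  product \<open>1\<close> or \<open>-1\<close>. So each factor has two coefficients fixed up to sign.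
\<close>

lemma reducible_factors:
  assumes P: "P \<in> monic_unit_polys m N" "0 < m" "1 \<le> N" and red: "\<not> irreducible P"
  shows "\<exists>e Q R. 0 < e \<and> e < m \<and> Q \<in> unit_polys e (2 ^ m * (m + 1) * N) \<and>
    R \<in> unit_polys (m - e) (2 ^ m * (m + 1) * N) \<and> P = Q * R"
proof -
  note PD = monic_unit_polysD[OF P(1,2)]
  have P0: "P \<noteq> 0" using PD(2) by auto
  have "\<not> P dvd 1"
  proof
    assume "P dvd 1"
    hence "P = 1 \<or> P = - 1" by (rule is_unit_int_poly)
    hence "degree P = 0" by auto
    thus False using PD(1) P(2) by simp
  qed
  then obtain Q R where QR: "P = Q * R" "\<not> Q dvd 1" "\<not> R dvd 1"
    using red P0 unfolding irreducible_def by blast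
  have nz: "Q \<noteq> 0" "R \<noteq> 0" using P0 QR(1) by auto
  have lc: "lead_coeff Q * lead_coeff R = 1" using PD(2) unfolding QR(1) lead_coeff_mult .
  have cc: "coeff Q 0 * coeff R 0 = coeff P 0" unfolding QR(1) by (simp add: coeff_mult_0)
  have lc1: "\<bar>lead_coeff Q\<bar> = 1" "\<bar>lead_coeff R\<bar> = 1"
    using lc by (metis abs_1 dvdI zdvd1_eq, metis abs_1 dvdI mult.commute zdvd1_eq)
  have "\<bar>coeff Q 0\<bar> * \<bar>coeff R 0\<bar> = 1" using cc PD(3) by (metis abs_mult)
  hence cc1: "\<bar>coeff Q 0\<bar> = 1" "\<bar>coeff R 0\<bar> = 1"
    by (metis abs_ge_zero abs_of_nonneg dvdI zdvd1_eq, metis abs_ge_zero abs_of_nonneg dvdI mult.commute zdvd1_eq)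
  have pos: "0 < degree U" if "\<bar>lead_coeff U\<bar> = 1" "\<not> U dvd 1" for U :: "int poly"
  proof (rule ccontr)
    assume "\<not> 0 < degree U"
    then obtain c where "U = [:c:]" by (metis degree_0_id gr0I)
    with that show False by (simp add: is_unit_const_poly_iff)
  qed
  have deg: "m = degree Q + degree R" using PD(1) QR(1) nz by (simp add: degree_mult_eq)
  let ?H = "2 ^ m * (m + 1) * N"
  have "\<bar>coeff Q i\<bar> \<le> int ?H" "\<bar>coeff R i\<bar> \<le> int ?H" for i
    by (rule factor_coeff_bound[OF P0 _ PD(4)[OF P(3)]]; use PD(1) QR(1) in simp)+
  hence "Q \<in> unit_polys (degree Q) ?H" "R \<in> unit_polys (m - degree Q) ?H"
    using lc1 cc1 deg by (auto intro!: in_unit_polys)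
  moreover have "0 < degree Q" "degree Q < m" using pos[of Q] pos[of R] lc1 QR deg by auto
  ultimately show ?thesis using QR(1) by blast
qed

text \<open>
  Factors of degrees \<open>e\<close> and \<open>m - e\<close> have \<open>e - 1\<close> and \<open>m - e - 1\<close> free coefficients, each of size \<open>O(N)\<close>:
  altogether \<open>m - 2 = k\<close> free coefficients, one less than for the polynomials being counted.
\<close>

lemma card_reducible:
  assumes "1 \<le> N"
  shows "card {P \<in> monic_unit_polys (k + 2) N. \<not> irreducible P}
    \<le> 16 * (k + 1) * (2 * (2 ^ (k + 2) * (k + 3) * N) + 1) ^ k"
proof -
  define H where "H = 2 ^ (k + 2) * (k + 3) * N"
  define b where "b = 2 * H + 1"
  let ?U = "\<lambda>e. (\<lambda>(Q, R). Q * R) ` (unit_polys e H \<times> unit_polys (k + 2 - e) H)"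
  have "{P \<in> monic_unit_polys (k + 2) N. \<not> irreducible P} \<subseteq> (\<Union>e\<in>{1..k + 1}. ?U e)"
  proof safe
    fix P assume P: "P \<in> monic_unit_polys (k + 2) N" "\<not> irreducible P"
    have k: "0 < k + 2" "k + 2 + 1 = k + 3" by simp_all
    obtain e Q R where "0 < e" "e < k + 2" "Q \<in> unit_polys e H" "R \<in> unit_polys (k + 2 - e) H" "P = Q * R"
      using reducible_factors[OF P(1) k(1) assms P(2)] unfolding H_def k(2) by blast
    thus "P \<in> (\<Union>e\<in>{1..k + 1}. ?U e)" by (intro UN_I[of e]) auto
  qed
  hence "card {P \<in> monic_unit_polys (k + 2) N. \<not> irreducible P} \<le> card (\<Union>e\<in>{1..k + 1}. ?U e)"
    by (intro card_mono finite_UN_I finite_imageI finite_cartesian_product finite_unit_polys) auto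
  also have "\<dots> \<le> (\<Sum>e\<in>{1..k + 1}. card (?U e))" by (rule card_UN_le) simp
  also have "\<dots> \<le> (\<Sum>e\<in>{1..k + 1}. 16 * b ^ k)"
  proof (rule sum_mono)
    fix e assume e: "e \<in> {1..k + 1}"
    then obtain e' where e': "e = Suc e'" by (cases e) auto
    hence "k + 2 - e = Suc (k - e')" using e by simp
    hence "card (unit_polys e H \<times> unit_polys (k + 2 - e) H)
        = 4 * b ^ e' * (4 * b ^ (k - e'))"
      unfolding e' by (simp only: card_cartesian_product card_unit_polys b_def)
    also have "\<dots> = 16 * (b ^ e' * b ^ (k - e'))" by simp
    also have "\<dots> = 16 * b ^ k" using e e' by (simp only: power_add[symmetric]) simp
    finally show "card (?U e) \<le> 16 * b ^ k"
      using card_image_le[OF finite_cartesian_product[OF finite_unit_polys finite_unit_polys]] by metis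
  qed
  also have "\<dots> = 16 * (k + 1) * b ^ k" by (simp add: algebra_simps)
  finally show ?thesis unfolding b_def H_def .
qed

section \<open>Roots of polynomials with large trace, and the count\<close>

text \<open>
  Divided by \<open>z^k\<close>, the equation \<open>P(z) = 0\<close> says that \<open>z\<close> differs from minus the coefficient of degree
  \<open>k\<close> by a polynomial in \<open>1 / z\<close>. This polynomial is a contraction for \<open>|z| \<ge> r\<close>: its Lipschitz
  constant with respect to \<open>z\<close> is at most \<open>k\<^sup>2 N / r\<^sup>2 < 1\<close>. So there cannot be two such roots.
\<close>

lemma large_root_unique:
  fixes P :: "int poly" and N r :: real
  assumes P: "degree P = k + 1" "lead_coeff P = 1" "\<And>i. \<bar>real_of_int (coeff P i)\<bar> \<le> N"
    and r: "1 \<le> r" "(real k)\<^sup>2 * N < r\<^sup>2"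
    and u: "ipoly P u = 0" "r \<le> cmod u" and v: "ipoly P v = 0" "r \<le> cmod v"
  shows "u = v"
proof (rule ccontr)
  assume "u \<noteq> v"
  have N0: "0 \<le> N" using P(3)[of 0] by simp
  have lc: "coeff P (k + 1) = 1" using P(1,2) by simp
  have inverse_eq: "z + of_int (coeff P k) = - (\<Sum>i<k. of_int (coeff P i) * inverse z ^ (k - i))"
    if z: "ipoly P z = 0" "r \<le> cmod z" for z
  proof -
    have z0: "z \<noteq> 0" using z(2) r(1) by auto
    have "0 = inverse z ^ k * ipoly P z" using z by simp
    also have "ipoly P z = (\<Sum>i\<le>k + 1. of_int (coeff P i) * z ^ i)"
      by (simp add: poly_altdef P(1))
    also have "\<dots> = (\<Sum>i<k. of_int (coeff P i) * z ^ i) + of_int (coeff P k) * z ^ k + z ^ (k + 1)"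
      using lc by (simp flip: lessThan_Suc_atMost)
    also have "inverse z ^ k * \<dots> = (\<Sum>i<k. of_int (coeff P i) * (inverse z ^ k * z ^ i)) +
        of_int (coeff P k) * (inverse z ^ k * z ^ k) + (inverse z ^ k * z ^ k) * z"
      by (simp add: algebra_simps sum_distrib_left)
    also have "inverse z ^ k * z ^ k = 1" using z0 by (simp flip: power_mult_distrib)
    also have "(\<Sum>i<k. of_int (coeff P i) * (inverse z ^ k * z ^ i)) =
        (\<Sum>i<k. of_int (coeff P i) * inverse z ^ (k - i))"
    proof (rule sum.cong[OF refl])
      fix i assume "i \<in> {..<k}"
      hence "inverse z ^ k = inverse z ^ (k - i) * inverse z ^ i" by (simp flip: power_add)
      moreover have "inverse z ^ i * z ^ i = 1" using z0 by (simp flip: power_mult_distrib)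
      ultimately show "of_int (coeff P i) * (inverse z ^ k * z ^ i) = of_int (coeff P i) * inverse z ^ (k - i)"
        by (simp add: mult.assoc)
    qed
    finally have eq: "(\<Sum>i<k. of_int (coeff P i) * inverse z ^ (k - i)) + (z + of_int (coeff P k)) = 0"
      by (simp add: add_ac)
    show ?thesis using eq_neg_iff_add_eq_0[THEN iffD2, OF eq] by simp
  qed
  have uv: "0 < cmod u" "0 < cmod v" using u v r by linarith+
  have inv1: "cmod (inverse u) \<le> 1" "cmod (inverse v) \<le> 1"
    using u(2) v(2) r(1) by (simp_all add: norm_inverse inverse_le_1_iff)
  have inv_diff: "cmod (inverse v - inverse u) \<le> cmod (u - v) / r\<^sup>2"
  proof -
    have "inverse v - inverse u = (u - v) / (u * v)" using uv by (auto simp: field_simps)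
    hence "cmod (inverse v - inverse u) = cmod (u - v) / (cmod u * cmod v)"
      by (simp add: norm_divide norm_mult)
    also have "\<dots> \<le> cmod (u - v) / r\<^sup>2"
    proof (rule divide_left_mono)
      show "r\<^sup>2 \<le> cmod u * cmod v"
        using u(2) v(2) r(1) unfolding power2_eq_square by (intro mult_mono) auto
      show "0 < cmod u * cmod v * r\<^sup>2" using uv r(1) by (intro mult_pos_pos) auto
    qed simp
    finally show ?thesis .
  qed
  have "u - v = (u + of_int (coeff P k)) - (v + of_int (coeff P k))" by simp
  also have "\<dots> = (\<Sum>i<k. of_int (coeff P i) * (inverse v ^ (k - i) - inverse u ^ (k - i)))"
    unfolding inverse_eq[OF u] inverse_eq[OF v] by (simp add: sum_subtractf algebra_simps)
  also have "cmod \<dots> \<le> (\<Sum>i<k. N * (real k * (cmod (u - v) / r\<^sup>2)))"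
  proof (rule sum_norm_le)
    fix i assume "i \<in> {..<k}"
    have "cmod (inverse v ^ (k - i) - inverse u ^ (k - i)) \<le> real (k - i) * cmod (inverse v - inverse u)"
      by (rule norm_power_diff) (use inv1 in auto)
    also have "\<dots> \<le> real k * (cmod (u - v) / r\<^sup>2)"
      using inv_diff by (intro mult_mono) auto
    finally show "cmod (of_int (coeff P i) * (inverse v ^ (k - i) - inverse u ^ (k - i)))
        \<le> N * (real k * (cmod (u - v) / r\<^sup>2))"
      using P(3)[of i] N0 unfolding norm_mult by (intro mult_mono) auto
  qed
  also have "\<dots> = ((real k)\<^sup>2 * N) * cmod (u - v) / r\<^sup>2" by (simp add: power2_eq_square)
  also have "\<dots> < r\<^sup>2 * cmod (u - v) / r\<^sup>2"
    using r \<open>u \<noteq> v\<close> by (intro divide_strict_right_mono mult_strict_right_mono) auto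
  also have "\<dots> = cmod (u - v)" using r(1) by simp
  finally show False by simp
qed

text \<open>
  The sum of the \<open>k + 1\<close> roots exceeds \<open>(k + 1) r\<close> in absolute value, so one root exceeds \<open>r\<close>; the product
  of all roots has absolute value \<open>1\<close>, so another one must be smaller than \<open>1\<close>.
\<close>

lemma dominant_and_small_root:
  fixes P :: "int poly" and N r :: real
  assumes P: "irreducible P" "degree P = k + 1" "lead_coeff P = 1" "\<bar>coeff P 0\<bar> = 1"
      "\<And>i. \<bar>real_of_int (coeff P i)\<bar> \<le> N"
    and r: "1 < r" "(real k)\<^sup>2 * N < r\<^sup>2" and trace: "real (k + 1) * r < \<bar>real_of_int (coeff P k)\<bar>"
  shows "\<exists>\<theta> \<alpha>. ipoly P \<theta> = 0 \<and> r \<le> cmod \<theta> \<and>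
    (\<forall>z. ipoly P z = 0 \<longrightarrow> z \<noteq> \<theta> \<longrightarrow> cmod z < cmod \<theta>) \<and> ipoly P \<alpha> = 0 \<and> cmod \<alpha> < 1"
proof -
  let ?Z = "{z. ipoly P z = 0}"
  note roots = monic_irreducible_roots[OF P(1,3)]
  have Z: "?Z \<noteq> {}" using roots(2) P(2) by force
  have "\<exists>\<theta>\<in>?Z. r \<le> cmod \<theta>"
  proof (rule ccontr)
    assume small: "\<not> (\<exists>\<theta>\<in>?Z. r \<le> cmod \<theta>)"
    have "\<bar>real_of_int (coeff P k)\<bar> = cmod (coeff (of_int_poly P) k)" by simp
    also have "coeff (of_int_poly P) k = coeff (\<Prod>z\<in>?Z. [:- z, 1:]) (card ?Z - 1)"
      using roots(2,3) P(2) by (metis add_diff_cancel_right')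
    also have "\<dots> = - \<Sum>?Z" by (rule coeff_prod_linear_next_to_leading[OF roots(1) Z])
    also have "cmod (- \<Sum>?Z) \<le> (\<Sum>z\<in>?Z. cmod z)" by (simp add: norm_sum)
    also have "\<dots> \<le> (\<Sum>z\<in>?Z. r)" using small by (intro sum_mono) auto
    also have "\<dots> = real (k + 1) * r" using roots(2) P(2) by simp
    finally show False using trace by simp
  qed
  then obtain \<theta> where \<theta>: "ipoly P \<theta> = 0" "r \<le> cmod \<theta>" by blast
  have dom: "cmod z < cmod \<theta>" if "ipoly P z = 0" "z \<noteq> \<theta>" for z
    using large_root_unique[OF P(2,3,5) _ r(2) that(1) _ \<theta>] that(2) r(1) \<theta>(2) by fastforce
  have "cmod (of_int (coeff P 0)) = cmod (poly (of_int_poly P) 0)" by (simp add: poly_0_coeff_0)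
  also have "\<dots> = cmod (poly (\<Prod>z\<in>?Z. [:- z, 1:]) 0)" using roots(3) by (rule arg_cong)
  also have "\<dots> = (\<Prod>z\<in>?Z. cmod (- z))" by (simp only: poly_prod prod_norm) simp
  also have "\<dots> = (\<Prod>z\<in>?Z. cmod z)" by simp
  also have "\<dots> = cmod \<theta> * (\<Prod>z\<in>?Z - {\<theta>}. cmod z)"
    by (rule prod.remove) (use roots(1) \<theta> in auto)
  finally have prod1: "cmod \<theta> * (\<Prod>z\<in>?Z - {\<theta>}. cmod z) = 1" using P(4) by simp
  have "\<exists>\<alpha>\<in>?Z. cmod \<alpha> < 1"
  proof (rule ccontr)
    assume "\<not> (\<exists>\<alpha>\<in>?Z. cmod \<alpha> < 1)"
    hence "1 \<le> (\<Prod>z\<in>?Z - {\<theta>}. cmod z)" by (intro prod_ge_1) auto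
    hence "cmod \<theta> * 1 \<le> cmod \<theta> * (\<Prod>z\<in>?Z - {\<theta>}. cmod z)" by (rule mult_left_mono) simp
    thus False using prod1 \<theta>(2) r(1) by simp
  qed
  thus ?thesis using \<theta> dom by blast
qed

text \<open>
  Here \<open>N\<close> is the integer part of \<open>X\<close>, and \<open>k = m - 2\<close>. The three terms of the constant come from
  replacing \<open>2 N + 1\<close> by \<open>2 X\<close> in the main term (inequality of Bernoulli), from the polynomials with
  small trace, and from the reducible ones.
\<close>

lemma counting_estimate:
  fixes X a :: real and k N T :: nat
  assumes X: "2 \<le> X" and N: "real N \<le> X" "X < real N + 1" and a: "0 \<le> a" and T: "real T \<le> a * sqrt X"
  shows "2 ^ (k + 2) * X ^ (k + 1) -
      (real (k + 1) * 2 ^ (k + 1) + 2 * (2 * a + 1) * 3 ^ k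
        + 16 * real (k + 1) * (2 * (2 ^ (k + 2) * real (k + 3)) + 1) ^ k) * X powr (real (k + 2) - 3 / 2)
    \<le> 2 * (2 * real N + 1) ^ (k + 1) - 2 * (2 * real T + 1) * (2 * real N + 1) ^ k
      - 16 * real (k + 1) * (2 * (2 ^ (k + 2) * real (k + 3) * real N) + 1) ^ k"
proof -
  define p where "p = X powr (real (k + 2) - 3 / 2)"
  define h where "h = 2 ^ (k + 2) * real (k + 3)"
  have h: "0 \<le> h" by (simp add: h_def)
  have sq: "1 \<le> sqrt X" using X by simp
  have p: "p = X ^ k * sqrt X"
  proof -
    have "p = X powr (real k + 1 / 2)" by (simp add: p_def algebra_simps)
    thus ?thesis using X by (simp add: powr_add powr_realpow powr_half_sqrt)
  qed
  have kp: "X ^ k \<le> p" unfolding p using sq X mult_left_mono[of 1 "sqrt X" "X ^ k"] by simp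
  have main: "2 ^ (k + 2) * X ^ (k + 1) - real (k + 1) * 2 ^ (k + 1) * p \<le> 2 * (2 * real N + 1) ^ (k + 1)"
  proof -
    have "1 + real (k + 1) * (- (1 / (2 * X))) \<le> (1 + (- (1 / (2 * X)))) ^ (k + 1)"
      by (rule Bernoulli_inequality) (use X in simp)
    hence "(2 * X) ^ (k + 1) * (1 + real (k + 1) * (- (1 / (2 * X)))) \<le> (2 * X) ^ (k + 1) * (1 + (- (1 / (2 * X)))) ^ (k + 1)"
      using X by (intro mult_left_mono) auto
    also have "\<dots> = (2 * X * (1 + (- (1 / (2 * X))))) ^ (k + 1)" by (simp only: power_mult_distrib)
    also have "2 * X * (1 + (- (1 / (2 * X)))) = 2 * X - 1" using X by (simp add: field_simps)
    also have "(2 * X - 1) ^ (k + 1) \<le> (2 * real N + 1) ^ (k + 1)"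
      using X N by (intro power_mono) auto
    also have "(2 * X) ^ (k + 1) * (1 + real (k + 1) * (- (1 / (2 * X))))
        = (2 * X) ^ (k + 1) - real (k + 1) * (2 * X) ^ k"
      using X by (simp add: field_simps)
    finally have "2 * ((2 * X) ^ (k + 1) - real (k + 1) * (2 * X) ^ k) \<le> 2 * (2 * real N + 1) ^ (k + 1)"
      by simp
    moreover have "2 * ((2 * X) ^ (k + 1) - real (k + 1) * (2 * X) ^ k)
        = 2 ^ (k + 2) * X ^ (k + 1) - real (k + 1) * 2 ^ (k + 1) * X ^ k"
      by (simp add: power_mult_distrib algebra_simps)
    moreover have "real (k + 1) * 2 ^ (k + 1) * X ^ k \<le> real (k + 1) * 2 ^ (k + 1) * p"
      using kp by (intro mult_left_mono) auto
    ultimately show ?thesis by linarith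
  qed
  have bad1: "2 * (2 * real T + 1) * (2 * real N + 1) ^ k \<le> 2 * (2 * a + 1) * 3 ^ k * p"
  proof -
    have "(2 * a + 1) * sqrt X = 2 * (a * sqrt X) + sqrt X" by (simp add: distrib_right)
    hence "2 * real T + 1 \<le> (2 * a + 1) * sqrt X" using T sq by linarith
    moreover have "2 * real N + 1 \<le> 3 * X" using N X by linarith
    ultimately have "2 * (2 * real T + 1) * (2 * real N + 1) ^ k \<le> 2 * ((2 * a + 1) * sqrt X) * (3 * X) ^ k"
      using a X by (intro mult_mono power_mono mult_left_mono) auto
    also have "\<dots> = 2 * (2 * a + 1) * 3 ^ k * p" by (simp add: p power_mult_distrib)
    finally show ?thesis .
  qed
  have bad2: "16 * real (k + 1) * (2 * (h * real N) + 1) ^ k \<le> 16 * real (k + 1) * (2 * h + 1) ^ k * p"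
  proof -
    have "2 * (h * real N) + 1 \<le> 2 * (h * X) + X"
      using N X h by (intro add_mono mult_left_mono) auto
    also have "\<dots> = (2 * h + 1) * X" by (simp add: algebra_simps)
    finally have "(2 * (h * real N) + 1) ^ k \<le> ((2 * h + 1) * X) ^ k"
      using h by (intro power_mono) auto
    also have "\<dots> = (2 * h + 1) ^ k * X ^ k" by (rule power_mult_distrib)
    also have "\<dots> \<le> (2 * h + 1) ^ k * p" using kp h by (intro mult_left_mono) auto
    finally have "16 * real (k + 1) * (2 * (h * real N) + 1) ^ k \<le> 16 * real (k + 1) * ((2 * h + 1) ^ k * p)"
      by (rule mult_left_mono) simp
    thus ?thesis by (simp only: mult.assoc)
  qed
  have combine: "u - (c1 + c2 + c3) * p \<le> v1 - v2 - v3"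
    if "u - c1 * p \<le> v1" "v2 \<le> c2 * p" "v3 \<le> c3 * p" for u c1 c2 c3 v1 v2 v3 :: real
    using that by (simp add: algebra_simps)
  show ?thesis unfolding p_def[symmetric] h_def[symmetric]
    by (rule combine[OF main bad1 bad2])
qed

theorem corollary1p8:
  fixes f :: "int fps" and m :: nat
  assumes "generalized_liouville_series f"
    and "bounded_type f"
    and "m \<ge> 2"
  shows "\<exists>C::real. C > 0 \<and> (\<forall>X::real. X \<ge> 2 \<longrightarrow>
    (\<exists>S :: complex set. finite S \<and>
      S \<subseteq> {\<alpha>. algebraic \<alpha> \<and> algebraic_degree \<alpha> = m \<and> cmod \<alpha> < 1 \<and>
             real_of_int (max_abs_coeff (int_min_poly \<alpha>)) \<le> X \<and>
             eval_fps (complex_fps f) \<alpha> \<in> U_numbers m} \<and>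
      real (card S) \<ge> 2 ^ m * X ^ (m - 1) - C * X powr (real m - 3 / 2) * ln X))"
proof -
  obtain k where m: "m = k + 2" using assms(3) by (metis add.commute le_Suc_ex)
  obtain s t :: "nat \<Rightarrow> nat" and B :: real where st:
      "\<And>n. 1 \<le> n \<Longrightarrow> t (n - 1) \<le> s n \<and> s n < t n"
      "\<And>n k. 1 \<le> n \<Longrightarrow> s n < k \<Longrightarrow> k < t n \<Longrightarrow> fps_nth f k = 0"
      "filterlim (\<lambda>n. real (t n) / real (s n)) at_top sequentially"
      "\<And>n. 1 \<le> n \<Longrightarrow> real (s (n + 1)) / real (t n) \<le> B"
    and inf: "infinite {k. fps_nth f k \<noteq> 0}"
    using assms(1) unfolding generalized_liouville_series_def by blast
  obtain A0 where A0: "\<And>k. real_of_int \<bar>fps_nth f k\<bar> \<le> A0"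
    using assms(2) unfolding bounded_type_def by blast
  define A where "A = max 1 A0"
  have A: "1 \<le> A" "\<And>k. \<bar>real_of_int (fps_nth f k)\<bar> \<le> A"
    using A0 by (auto simp: A_def le_max_iff_disj)
  define a where "a = real m * (real m + 2 * A + 2)"
  define C0 where "C0 = real (k + 1) * 2 ^ (k + 1) + 2 * (2 * a + 1) * 3 ^ k
        + 16 * real (k + 1) * (2 * (2 ^ (k + 2) * real (k + 3)) + 1) ^ k"
  have a: "0 \<le> a" using A(1) by (simp add: a_def)
  have C0: "0 < C0" unfolding C0_def using a by (intro add_pos_nonneg) auto
  show ?thesis
  proof (intro exI[of _ "C0 / ln 2"] conjI allI impI)
    show "0 < C0 / ln 2" using C0 by simp
    fix X :: real assume X: "2 \<le> X"
    define N where "N = nat \<lfloor>X\<rfloor>"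
    have N: "real N \<le> X" "X < real N + 1" "1 \<le> N" using X by (auto simp: N_def le_nat_iff le_floor_iff)
    \<comment> \<open>Large enough for the uniqueness of the large root and for the size required of \<open>\<theta>\<close>, yet \<open>O(sqrt X)\<close>.\<close>
    define r where "r = real m * sqrt X + 2 * A + 2"
    have sq: "1 \<le> sqrt X" using X by simp
    define T where "T = nat \<lfloor>real m * r\<rfloor>"
    have r0: "0 \<le> real m * r" using A(1) X by (simp add: r_def)
    have T: "real T \<le> a * sqrt X"
    proof -
      have "real T \<le> real m * r" using r0 by (simp add: T_def)
      also have "r \<le> (real m + 2 * A + 2) * sqrt X"
        using sq A(1) mult_left_mono[of 1 "sqrt X" "2 * A + 2"] by (simp add: r_def algebra_simps)
      finally show ?thesis by (simp add: a_def mult.assoc mult_left_mono)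
    qed
    let ?F = "monic_unit_polys m N"
    define G where "G = ?F - {P \<in> ?F. \<bar>coeff P (k + 1)\<bar> \<le> int T} - {P \<in> ?F. \<not> irreducible P}"
    have "\<exists>\<alpha>. ipoly P \<alpha> = 0 \<and> cmod \<alpha> < 1 \<and> eval_fps (complex_fps f) \<alpha> \<in> U_numbers m" if "P \<in> G" for P
    proof -
      have PF: "P \<in> ?F" and irr: "irreducible P" and tr: "int T < \<bar>coeff P (k + 1)\<bar>"
        using that by (auto simp: G_def)
      have "0 < m" by (simp add: m)
      note PD = monic_unit_polysD[OF PF this]
      have coeffN: "\<bar>real_of_int (coeff P i)\<bar> \<le> real N" for i
        using PD(4)[OF N(3), of i] by linarith
      have "real m * r < \<bar>real_of_int (coeff P (k + 1))\<bar>"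
        using tr r0 unfolding T_def by linarith
      moreover have "(real (k + 1))\<^sup>2 * real N < r\<^sup>2"
      proof -
        have "(real (k + 1))\<^sup>2 * real N \<le> (real m)\<^sup>2 * X"
          using N by (intro mult_mono power_mono) (auto simp: m)
        also have "\<dots> = (real m * sqrt X)\<^sup>2" using X by (simp add: power_mult_distrib)
        also have "\<dots> < r\<^sup>2" using A(1) X by (intro power_strict_mono) (auto simp: r_def)
        finally show ?thesis .
      qed
      moreover have "1 < r" using A(1) X by (simp add: r_def add_nonneg_pos)
      ultimately obtain \<theta> \<alpha> where \<theta>: "ipoly P \<theta> = 0" "r \<le> cmod \<theta>"
          "\<And>z. ipoly P z = 0 \<Longrightarrow> z \<noteq> \<theta> \<Longrightarrow> cmod z < cmod \<theta>"
        and \<alpha>: "ipoly P \<alpha> = 0" "cmod \<alpha> < 1"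
        using dominant_and_small_root[of P "k + 1" "real N" r] irr PD(1-3) coeffN by (auto simp: m)
      have "2 * A + 2 \<le> r" using X by (simp add: r_def)
      hence \<theta>A: "2 * A + 2 \<le> cmod \<theta>" using \<theta>(2) by linarith
      interpret liouville_value f s t A B P \<alpha> \<theta>
        by unfold_locales (fact st inf A irr PD(2) \<alpha> \<theta> \<theta>A)+
      show ?thesis using value_in_U \<alpha> PD(1) by auto
    qed
    then obtain root where root: "\<And>P. P \<in> G \<Longrightarrow> ipoly P (root P) = 0"
        "\<And>P. P \<in> G \<Longrightarrow> cmod (root P) < 1"
        "\<And>P. P \<in> G \<Longrightarrow> eval_fps (complex_fps f) (root P) \<in> U_numbers m"
      by metis
    have GD: "irreducible P" "degree P = m" "lead_coeff P = 1" "\<bar>coeff P i\<bar> \<le> int N" if "P \<in> G" for P i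
      using that monic_unit_polysD[of P m N] N(3) by (auto simp: G_def m)
    have inj: "inj_on root G"
    proof (rule inj_onI)
      fix P Q assume PQ: "P \<in> G" "Q \<in> G" "root P = root Q"
      hence "P = Q \<or> P = - Q"
        using irreducible_common_root_eq[of P "root P" Q] GD(1) root(1) by metis
      thus "P = Q" using GD(3)[OF PQ(1)] GD(3)[OF PQ(2)] by auto
    qed
    have finF: "finite ?F" by (rule finite_monic_unit_polys)
    hence finG: "finite G" by (simp add: G_def)
    show "\<exists>S. finite S \<and> S \<subseteq> {\<alpha>. algebraic \<alpha> \<and> algebraic_degree \<alpha> = m \<and> cmod \<alpha> < 1 \<and>
             real_of_int (max_abs_coeff (int_min_poly \<alpha>)) \<le> X \<and>
             eval_fps (complex_fps f) \<alpha> \<in> U_numbers m} \<and>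
      real (card S) \<ge> 2 ^ m * X ^ (m - 1) - C0 / ln 2 * X powr (real m - 3 / 2) * ln X"
    proof (intro exI[of _ "root ` G"] conjI)
      show "finite (root ` G)" using finG by simp
      show "root ` G \<subseteq> {\<alpha>. algebraic \<alpha> \<and> algebraic_degree \<alpha> = m \<and> cmod \<alpha> < 1 \<and>
             real_of_int (max_abs_coeff (int_min_poly \<alpha>)) \<le> X \<and>
             eval_fps (complex_fps f) \<alpha> \<in> U_numbers m}"
      proof safe
        fix P assume P: "P \<in> G"
        have "P \<noteq> 0" using GD(1)[OF P] by auto
        thus "algebraic (root P)" using root(1)[OF P] algebraic_iff_ipoly by blast
        show "algebraic_degree (root P) = m"
          using algebraic_degree_eq[OF GD(1)[OF P] root(1)[OF P]] GD(2)[OF P] by simp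
        have "max_abs_coeff (int_min_poly (root P)) = max_abs_coeff P"
          using int_min_poly_eq[OF GD(1)[OF P] root(1)[OF P]] by auto
        also have "\<dots> \<le> int N" using GD(4)[OF P] by (rule max_abs_coeff_le)
        finally show "real_of_int (max_abs_coeff (int_min_poly (root P))) \<le> X" using N(1) by linarith
      qed (use root in auto)
      have "card ?F - card {P \<in> ?F. \<bar>coeff P (k + 1)\<bar> \<le> int T} - card {P \<in> ?F. \<not> irreducible P} \<le> card G"
        unfolding G_def using finF
        by (intro order_trans[OF diff_le_mono diff_card_le_card_Diff] diff_card_le_card_Diff) auto
      hence "real (card ?F) - real (card {P \<in> ?F. \<bar>coeff P (k + 1)\<bar> \<le> int T})
          - real (card {P \<in> ?F. \<not> irreducible P}) \<le> real (card G)"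
        by linarith
      moreover have "real (card ?F) = 2 * (2 * real N + 1) ^ (k + 1)"
      proof -
        have "card ?F = 2 * (2 * N + 1) ^ (k + 1)"
          using card_monic_unit_polys[of "k + 1" N] by (simp add: m)
        thus ?thesis
          by (simp only: of_nat_mult semiring_1_class.of_nat_power of_nat_add of_nat_numeral of_nat_1)
      qed
      moreover have "real (card {P \<in> ?F. \<bar>coeff P (k + 1)\<bar> \<le> int T})
          \<le> real (2 * (2 * T + 1) * (2 * N + 1) ^ k)"
        unfolding m by (intro of_nat_mono card_small_trace)
      moreover have "real (2 * (2 * T + 1) * (2 * N + 1) ^ k) = 2 * (2 * real T + 1) * (2 * real N + 1) ^ k"
        by (simp only: of_nat_mult semiring_1_class.of_nat_power of_nat_add of_nat_numeral of_nat_1)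
      moreover have "real (card {P \<in> ?F. \<not> irreducible P})
          \<le> real (16 * (k + 1) * (2 * (2 ^ (k + 2) * (k + 3) * N) + 1) ^ k)"
        unfolding m by (intro of_nat_mono card_reducible N(3))
      moreover have "real (16 * (k + 1) * (2 * (2 ^ (k + 2) * (k + 3) * N) + 1) ^ k)
          = 16 * real (k + 1) * (2 * (2 ^ (k + 2) * real (k + 3) * real N) + 1) ^ k"
        by (simp only: of_nat_mult semiring_1_class.of_nat_power of_nat_add of_nat_numeral of_nat_1)
      ultimately have "2 * (2 * real N + 1) ^ (k + 1) - 2 * (2 * real T + 1) * (2 * real N + 1) ^ k
          - 16 * real (k + 1) * (2 * (2 ^ (k + 2) * real (k + 3) * real N) + 1) ^ k \<le> real (card G)"
        by linarith
      hence "2 ^ (k + 2) * X ^ (k + 1) - C0 * X powr (real (k + 2) - 3 / 2) \<le> real (card G)"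
        using counting_estimate[OF X N(1,2) a T, of k] unfolding C0_def by linarith
      moreover have "C0 * X powr (real m - 3 / 2) \<le> C0 / ln 2 * X powr (real m - 3 / 2) * ln X"
      proof -
        have "1 \<le> ln X / ln 2" using X by simp
        hence "C0 * X powr (real m - 3 / 2) * 1 \<le> C0 * X powr (real m - 3 / 2) * (ln X / ln 2)"
          using C0 by (intro mult_left_mono) auto
        thus ?thesis by (simp add: mult_ac)
      qed
      ultimately show "real (card (root ` G)) \<ge> 2 ^ m * X ^ (m - 1) - C0 / ln 2 * X powr (real m - 3 / 2) * ln X"
        using card_image[OF inj] by (simp add: m)
    qed
  qed
qed

end
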